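(* Let $\mathcal{T}_0$ be a theory over a signature $\Pi_0=(\Sigma_0,\mathsf{Pred})$ that allows quantifier elimination, let $\Sigma_P$ be a set of parameter symbols (function and constant symbols) and $\Sigma$ a set of function symbols with $\Sigma\cap(\Sigma_0\cup\Sigma_P)=\emptyset$, and let $\Pi=\Pi_0\cup\Sigma_P\cup\Sigma$. Assume that $\mathcal{K}=\mathcal{K}_P\cup\mathcal{K}_1$, where $\mathcal{K}_P$ is a set of clauses containing only symbols in $\Sigma_0\cup\Sigma_P$ and $\mathcal{K}_1$ is a set of $\Pi$-clauses, such that $$\mathcal{T}_0\subseteq\mathcal{T}_0\cup\mathcal{K}_P\subseteq\mathcal{T}_0\cup\mathcal{K}_P\cup\mathcal{K}_1$$ is a chain of theory extensions, both satisfying condition $(\mathsf{Comp}_f)$ and both having the property that all variables occur below an extension function, and such that $\mathcal{K}$ is flat and linear. Let $G$ be a finite set of ground $\Pi^C$-clauses. Let $\forall\overline{y}\,\Gamma_1(\overline{y})$ be the formula obtained by applying Algorithm 1 to $\mathcal{T}_0\cup\mathcal{K}_1\cup G$ (i.e. with axiom set $\mathcal{K}_1$, parameters $\Sigma_P$, and instantiation set $T=\mathsf{est}(\mathcal{K}_1,G)$). Then for every universal formula $\Gamma$ containing only parameters (i.e. only symbols in $\Sigma_0\cup\Sigma_P$) such that $\mathcal{T}_0\cup\mathcal{K}_P\cup\Gamma\cup\mathcal{K}_1\cup G\models\perp$, we have $\mathcal{K}_P\wedge\Gamma\models_{\mathcal{T}_0}\mathcal{K}_P\wedge\forall\overline{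y}\,\Gamma_1(\overline{y})$.
   Context: $\Pi^C$ denotes the extension of a signature $\Pi$ by a countable set $C$ of fresh constants. A finite set of ground clauses is identified with the conjunction of its clauses. For $F,G$ formulae, $F\models_{\mathcal{T}}G$ means every model of $\mathcal{T}$ satisfying $F$ satisfies $G$; $\perp$ is falsum. Theory extensions: given a base theory $\mathcal{T}_0$ and a set $\mathcal{K}$ of clauses in an extended signature with new function symbols (extension functions), $\mathcal{T}_0\cup\mathcal{K}$ is an extension of $\mathcal{T}_0$. For a finite set $G$ of ground clauses, $\mathsf{est}(\mathcal{K},G)$ is the set of ground terms starting with an extension function that occur in $\mathcal{K}$ or $G$; for a set $T$ of ground terms, $\mathcal{K}[T]$ is the set of instances of $\mathcal{K}$ in which all terms starting with an extension function are in $T$. The extension is local if for every finite set $G$ of ground clauses, $\mathcal{T}_0\cup\mathcal{K}\cup G$ is unsatisfiable iff $\mathcal{T}_0\cup\mathcal{K}[\mathsf{est}(\mathcal{K},G)]\cup G$ is unsatisfiable. The extension satisfies $(\mathsf{Comp}_f)$ if every partial model of $\mathcal{T}_0\cup\mathcal{K}$ whose reduct to $\Pi_0$ is a total model of $\mathcal{T}_0$ and in which the extension functions are partial functions with finite domain of definition (and which satisfies the clauses of $\mathcal{K}$ for all assignments under which all their terms are defined) weakly embeds into a total model of $\mathcal{T}_0\cup\mathcal{K}$ with the same universe (i.e. the partial extension functions can be completed to total ones without changing the universe). A set of clauses is flat if extension functions are applied only to variables (no nesting of extension terms), and linear if every variable occurs in at most one term starting with an extension function and no such term contains a variable twice. Algorithm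 1 (symbol elimination), for $\mathcal{K}$ a set of $\Pi$-clauses in which every variable occurs below a function in $\Sigma_1=\Sigma_P\cup\Sigma$, $G$ a finite set of ground $\Pi^C$-clauses and $T\supseteq\mathsf{est}(G)$ a finite set of ground terms: Step 1: purify $\mathcal{K}[T]\cup G$ by introducing (bottom-up) fresh constants $c_t$ for terms $t=f(g_1,\dots,g_n)$ with $f\in\Sigma_1$ and $g_i$ ground terms over $\Sigma_0$ and constants, replacing $t$ by $c_t$ and recording definitions $c_t\approx t$; obtain $\mathcal{K}_0\cup G_0\cup\mathsf{Con}_0$, where $\mathsf{Con}_0=\{(c_1\approx d_1\wedge\dots\wedge c_n\approx d_n)\to c\approx d\mid c\approx f(c_1,\dots,c_n),\ d\approx f(d_1,\dots,d_n)\text{ definitions}\}$. Step 2: let $G_1=\mathcal{K}_0\cup G_0\cup\mathsf{Con}_0$. Identify the constants $\overline{c_f}$ that are constant parameters or were introduced by definitions $c_f\approx f(c_1,\dots,c_k)$ with $f\in\Sigma_P$, and the constants $\overline{c_p}$ occurring as arguments of functions in $\Sigma_P$ in such definitions; replace all remaining constants $\overline{c}$ by existentially quantified variables, obtaining $\exists\overline{x}\,G_1(\overline{c_p},\overline{c_f},\overline{x})$. Step 3: using quantifier elimination in $\mathcal{T}_0$, compute a quantifier-free $\Gamma_1(\overline{c_p},\overline{c_f})$ equivalent modulo $\mathcal{T}_0$ to $\exists\overline{x}\,G_1$. Step 4: replace back each $c_f$ by the term $f(c_1,\dots,c_k)$ it was defined as, obtaining $\Gamma_2(\overline{c_p})$,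 and replace $\overline{c_p}$ by variables $\overline{y}$. Step 5: output $\forall\overline{y}\,\neg\Gamma_2(\overline{y})$.
   Formalization: In Steps 4–5, a constant in both c_p and c_f is not replaced by a variable: constant parameters stay, and defined constants are expanded exhaustively to parameter terms. Read literally, G={g(a)=1}, Γ: g(a)≠1 refutes the claim. *)

theory Defs
  imports "HOL-Library.Countable_Set"
begin

section \<open>Syntax\<close>

text \<open>A symbol is a name together with its arity, so a signature is a set of such pairs and
  the head symbol of \<^term>\<open>Fn f ts\<close> is \<^term>\<open>(f, length ts)\<close>. Constants are nullary symbols.\<close>

type_synonym 'f sig = "('f \<times> nat) set"

datatype 'f trm = Var nat | Fn 'f "'f trm list"

datatype ('p, terms_atom: 't) atom = Equ 't 't | Prd 'p "'t list"

datatype ('p, terms_lit: 't) lit = Pos "('p, 't) atom" | Neg "('p, 't) atom"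

type_synonym ('f, 'p) clause = "('p, 'f trm) lit list"

datatype ('p, terms_form: 't) form =
    FBot
  | FAtm "('p, 't) atom"
  | FNeg "('p, 't) form"
  | FAnd "('p, 't) form" "('p, 't) form"
  | FOr "('p, 't) form" "('p, 't) form"
  | FAll nat "('p, 't) form"
  | FEx nat "('p, 't) form"

type_synonym ('f, 'p) fml = "('p, 'f trm) form"

fun var_list :: "'f trm \<Rightarrow> nat list" where
  "var_list (Var x) = [x]"
| "var_list (Fn f ts) = concat (map var_list ts)"

abbreviation vars :: "'f trm \<Rightarrow> nat set" where
  "vars t \<equiv> set (var_list t)"

fun syms :: "'f trm \<Rightarrow> 'f sig" where
  "syms (Var x) = {}"
| "syms (Fn f ts) = insert (f, length ts) (\<Union>t\<in>set ts. syms t)"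

fun subterms :: "'f trm \<Rightarrow> 'f trm set" where
  "subterms (Var x) = {Var x}"
| "subterms (Fn f ts) = insert (Fn f ts) (\<Union>t\<in>set ts. subterms t)"

fun psyms_atom :: "('p, 't) atom \<Rightarrow> 'p sig" where
  "psyms_atom (Equ s t) = {}"
| "psyms_atom (Prd p ts) = {(p, length ts)}"

fun psyms_lit :: "('p, 't) lit \<Rightarrow> 'p sig" where
  "psyms_lit (Pos a) = psyms_atom a"
| "psyms_lit (Neg a) = psyms_atom a"

fun psyms_form :: "('p, 't) form \<Rightarrow> 'p sig" where
  "psyms_form FBot = {}"
| "psyms_form (FAtm a) = psyms_atom a"
| "psyms_form (FNeg \<phi>) = psyms_form \<phi>"
| "psyms_form (FAnd \<phi> \<psi>) = psyms_form \<phi> \<union> psyms_form \<psi>"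
| "psyms_form (FOr \<phi> \<psi>) = psyms_form \<phi> \<union> psyms_form \<psi>"
| "psyms_form (FAll x \<phi>) = psyms_form \<phi>"
| "psyms_form (FEx x \<phi>) = psyms_form \<phi>"

fun fv :: "('f, 'p) fml \<Rightarrow> nat set" where
  "fv FBot = {}"
| "fv (FAtm a) = (\<Union>t\<in>terms_atom a. vars t)"
| "fv (FNeg \<phi>) = fv \<phi>"
| "fv (FAnd \<phi> \<psi>) = fv \<phi> \<union> fv \<psi>"
| "fv (FOr \<phi> \<psi>) = fv \<phi> \<union> fv \<psi>"
| "fv (FAll x \<phi>) = fv \<phi> - {x}"
| "fv (FEx x \<phi>) = fv \<phi> - {x}"

fun quantifier_free :: "('p, 't) form \<Rightarrow> bool" where
  "quantifier_free (FNeg \<phi>) = quantifier_free \<phi>"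
| "quantifier_free (FAnd \<phi> \<psi>) = (quantifier_free \<phi> \<and> quantifier_free \<psi>)"
| "quantifier_free (FOr \<phi> \<psi>) = (quantifier_free \<phi> \<and> quantifier_free \<psi>)"
| "quantifier_free (FAll x \<phi>) = False"
| "quantifier_free (FEx x \<phi>) = False"
| "quantifier_free \<phi> = True"

fun universal :: "('p, 't) form \<Rightarrow> bool" where
  "universal (FAll x \<phi>) = universal \<phi>"
| "universal \<phi> = quantifier_free \<phi>"

definition over_form :: "'f sig \<Rightarrow> 'p sig \<Rightarrow> ('f, 'p) fml \<Rightarrow> bool" where
  "over_form S Pr \<phi> \<longleftrightarrow> (\<forall>t\<in>terms_form \<phi>. syms t \<subseteq> S) \<and> psyms_form \<phi> \<subseteq> Pr"

definition terms_clause :: "('f, 'p) clause \<Rightarrow> 'f trm set" where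
  "terms_clause D = (\<Union>l\<in>set D. terms_lit l)"

definition vars_clause :: "('f, 'p) clause \<Rightarrow> nat set" where
  "vars_clause D = (\<Union>t\<in>terms_clause D. vars t)"

definition syms_clause :: "('f, 'p) clause \<Rightarrow> 'f sig" where
  "syms_clause D = (\<Union>t\<in>terms_clause D. syms t)"

definition subterms_clause :: "('f, 'p) clause \<Rightarrow> 'f trm set" where
  "subterms_clause D = (\<Union>t\<in>terms_clause D. subterms t)"

definition over_clause :: "'f sig \<Rightarrow> 'p sig \<Rightarrow> ('f, 'p) clause \<Rightarrow> bool" where
  "over_clause S Pr D \<longleftrightarrow> syms_clause D \<subseteq> S \<and> (\<forall>l\<in>set D. psyms_lit l \<subseteq> Pr)"

definition ground_clause :: "('f, 'p) clause \<Rightarrow> bool" where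
  "ground_clause D \<longleftrightarrow> vars_clause D = {}"

definition map_clause :: "('f trm \<Rightarrow> 'f trm) \<Rightarrow> ('f, 'p) clause \<Rightarrow> ('f, 'p) clause" where
  "map_clause h D = map (map_lit id h) D"

fun form_of_lit :: "('p, 't) lit \<Rightarrow> ('p, 't) form" where
  "form_of_lit (Pos a) = FAtm a"
| "form_of_lit (Neg a) = FNeg (FAtm a)"

definition form_of_clause :: "('f, 'p) clause \<Rightarrow> ('f, 'p) fml" where
  "form_of_clause D = foldr FOr (map form_of_lit D) FBot"

definition conj_form :: "('f, 'p) clause list \<Rightarrow> ('f, 'p) fml" where
  "conj_form Ds = foldr FAnd (map form_of_clause Ds) (FNeg FBot)"

fun subst :: "(nat \<Rightarrow> 'f trm) \<Rightarrow> 'f trm \<Rightarrow> 'f trm" where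
  "subst \<sigma> (Var x) = \<sigma> x"
| "subst \<sigma> (Fn f ts) = Fn f (map (subst \<sigma>) ts)"

fun replace_consts :: "('f \<rightharpoonup> 'f trm) \<Rightarrow> 'f trm \<Rightarrow> 'f trm" where
  "replace_consts \<theta> (Var x) = Var x"
| "replace_consts \<theta> (Fn f ts) =
     (if ts = [] then (case \<theta> f of Some t \<Rightarrow> t | None \<Rightarrow> Fn f [])
      else Fn f (map (replace_consts \<theta>) ts))"


section \<open>Structures, models and entailment\<close>

text \<open>Universes are arbitrary nonempty subsets of a type. Notions that quantify over all
  structures take that type as an explicit argument.\<close>

record ('f, 'p, 'a) struct =
  univ :: "'a set"
  fn :: "'f \<Rightarrow> 'a list \<Rightarrow> 'a"
  pr :: "'p \<Rightarrow> 'a list \<Rightarrow> bool"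

definition tuples :: "'a set \<Rightarrow> nat \<Rightarrow> 'a list set" where
  "tuples U n = {as. length as = n \<and> set as \<subseteq> U}"

definition is_struct :: "'f sig \<Rightarrow> ('f, 'p, 'a) struct \<Rightarrow> bool" where
  "is_struct S M \<longleftrightarrow> univ M \<noteq> {} \<and>
     (\<forall>(f, n)\<in>S. \<forall>as\<in>tuples (univ M) n. fn M f as \<in> univ M)"

fun eval :: "('f, 'p, 'a) struct \<Rightarrow> (nat \<Rightarrow> 'a) \<Rightarrow> 'f trm \<Rightarrow> 'a" where
  "eval M v (Var x) = v x"
| "eval M v (Fn f ts) = fn M f (map (eval M v) ts)"

fun sat_atom :: "('f, 'p, 'a) struct \<Rightarrow> (nat \<Rightarrow> 'a) \<Rightarrow> ('p, 'f trm) atom \<Rightarrow> bool" where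
  "sat_atom M v (Equ s t) \<longleftrightarrow> eval M v s = eval M v t"
| "sat_atom M v (Prd p ts) \<longleftrightarrow> pr M p (map (eval M v) ts)"

fun sat :: "('f, 'p, 'a) struct \<Rightarrow> (nat \<Rightarrow> 'a) \<Rightarrow> ('f, 'p) fml \<Rightarrow> bool" where
  "sat M v FBot \<longleftrightarrow> False"
| "sat M v (FAtm a) \<longleftrightarrow> sat_atom M v a"
| "sat M v (FNeg \<phi>) \<longleftrightarrow> \<not> sat M v \<phi>"
| "sat M v (FAnd \<phi> \<psi>) \<longleftrightarrow> sat M v \<phi> \<and> sat M v \<psi>"
| "sat M v (FOr \<phi> \<psi>) \<longleftrightarrow> sat M v \<phi> \<or> sat M v \<psi>"
| "sat M v (FAll x \<phi>) \<longleftrightarrow> (\<forall>a\<in>univ M. sat M (v(x := a)) \<phi>)"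
| "sat M v (FEx x \<phi>) \<longleftrightarrow> (\<exists>a\<in>univ M. sat M (v(x := a)) \<phi>)"

definition holds :: "('f, 'p, 'a) struct \<Rightarrow> ('f, 'p) fml \<Rightarrow> bool" where
  "holds M \<phi> \<longleftrightarrow> (\<forall>v. range v \<subseteq> univ M \<longrightarrow> sat M v \<phi>)"

definition is_model :: "'f sig \<Rightarrow> ('f, 'p) fml set \<Rightarrow> ('f, 'p, 'a) struct \<Rightarrow> bool" where
  "is_model S \<Phi> M \<longleftrightarrow> is_struct S M \<and> (\<forall>\<phi>\<in>\<Phi>. holds M \<phi>)"

definition entails :: "'a itself \<Rightarrow> 'f sig \<Rightarrow> ('f, 'p) fml set \<Rightarrow> ('f, 'p) fml set \<Rightarrow> bool" where
  "entails A S \<Phi> \<Psi> \<longleftrightarrow> (\<forall>M :: ('f, 'p, 'a) struct. is_model S \<Phi> M \<longrightarrow> is_model S \<Psi> M)"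

definition equiv_mod ::
    "'a itself \<Rightarrow> 'f sig \<Rightarrow> ('f, 'p) fml set \<Rightarrow> ('f, 'p) fml \<Rightarrow> ('f, 'p) fml \<Rightarrow> bool" where
  "equiv_mod A S T0 \<phi> \<psi> \<longleftrightarrow>
     (\<forall>M :: ('f, 'p, 'a) struct. is_model S T0 M \<longrightarrow>
        (\<forall>v. range v \<subseteq> univ M \<longrightarrow> (sat M v \<phi> \<longleftrightarrow> sat M v \<psi>)))"

definition is_theory :: "'f sig \<Rightarrow> 'p sig \<Rightarrow> ('f, 'p) fml set \<Rightarrow> bool" where
  "is_theory S Pr T0 \<longleftrightarrow> (\<forall>\<phi>\<in>T0. over_form S Pr \<phi> \<and> fv \<phi> = {})"

definition allows_qe :: "'a itself \<Rightarrow> 'f sig \<Rightarrow> 'p sig \<Rightarrow> ('f, 'p) fml set \<Rightarrow> bool" where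
  "allows_qe A S Pr T0 \<longleftrightarrow>
     (\<forall>\<phi>. over_form S Pr \<phi> \<longrightarrow>
        (\<exists>\<psi>. over_form S Pr \<psi> \<and> quantifier_free \<psi> \<and> fv \<psi> \<subseteq> fv \<phi> \<and> equiv_mod A S T0 \<phi> \<psi>))"


section \<open>Partial structures and the finite completability condition\<close>

record ('f, 'p, 'a) pstruct =
  puniv :: "'a set"
  pfn :: "'f \<Rightarrow> 'a list \<Rightarrow> 'a option"
  ppr :: "'p \<Rightarrow> 'a list \<Rightarrow> bool"

definition is_pstruct :: "'f sig \<Rightarrow> ('f, 'p, 'a) pstruct \<Rightarrow> bool" where
  "is_pstruct S P \<longleftrightarrow> puniv P \<noteq> {} \<and>
     (\<forall>(f, n)\<in>S. \<forall>as\<in>tuples (puniv P) n. \<forall>b. pfn P f as = Some b \<longrightarrow> b \<in> puniv P)"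

definition fun_dom :: "('f, 'p, 'a) pstruct \<Rightarrow> 'f \<Rightarrow> nat \<Rightarrow> 'a list set" where
  "fun_dom P f n = {as\<in>tuples (puniv P) n. pfn P f as \<noteq> None}"

fun peval :: "('f, 'p, 'a) pstruct \<Rightarrow> (nat \<Rightarrow> 'a) \<Rightarrow> 'f trm \<Rightarrow> 'a option" where
  "peval P v (Var x) = Some (v x)"
| "peval P v (Fn f ts) =
     (case those (map (peval P v) ts) of None \<Rightarrow> None | Some as \<Rightarrow> pfn P f as)"

text \<open>The total structure below is only consulted on terms that are defined in \<^term>\<open>P\<close>,
  where evaluation in both structures agrees.\<close>

definition totalize :: "('f, 'p, 'a) pstruct \<Rightarrow> ('f, 'p, 'a) struct" where
  "totalize P = \<lparr>univ = puniv P, fn = (\<lambda>f as. the (pfn P f as)), pr = ppr P\<rparr>"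

definition weakly_satisfies :: "('f, 'p, 'a) pstruct \<Rightarrow> ('f, 'p) clause \<Rightarrow> bool" where
  "weakly_satisfies P D \<longleftrightarrow>
     (\<forall>v. range v \<subseteq> puniv P \<longrightarrow> (\<forall>t\<in>terms_clause D. peval P v t \<noteq> None) \<longrightarrow>
        sat (totalize P) v (form_of_clause D))"

definition weak_embedding ::
    "'f sig \<Rightarrow> 'p sig \<Rightarrow> ('a \<Rightarrow> 'b) \<Rightarrow> ('f, 'p, 'a) pstruct \<Rightarrow> ('f, 'p, 'b) struct \<Rightarrow> bool" where
  "weak_embedding S Pr h P B \<longleftrightarrow>
     inj_on h (puniv P) \<and> h ` puniv P \<subseteq> univ B \<and>
     (\<forall>(f, n)\<in>S. \<forall>as\<in>tuples (puniv P) n. \<forall>b.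
        pfn P f as = Some b \<longrightarrow> fn B f (map h as) = h b) \<and>
     (\<forall>(p, n)\<in>Pr. \<forall>as\<in>tuples (puniv P) n. ppr P p as \<longleftrightarrow> pr B p (map h as))"

text \<open>Since the base symbols are total in \<^term>\<open>P\<close>, that the identity is a weak embedding into a
  structure with the same universe means that this structure has the same base reduct and
  completes the partial extension functions.\<close>

definition comp_f ::
    "'a itself \<Rightarrow> 'f sig \<Rightarrow> 'f sig \<Rightarrow> 'p sig \<Rightarrow> ('f, 'p) fml set \<Rightarrow> ('f, 'p) clause set \<Rightarrow> bool" where
  "comp_f A S0 E Pr T0 K \<longleftrightarrow>
     (\<forall>P :: ('f, 'p, 'a) pstruct.
        is_pstruct (S0 \<union> E) P \<longrightarrow>
        (\<forall>(f, n)\<in>S0. fun_dom P f n = tuples (puniv P) n) \<longrightarrow>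
        is_model S0 T0 (totalize P) \<longrightarrow>
        (\<forall>(f, n)\<in>E. finite (fun_dom P f n)) \<longrightarrow>
        (\<forall>D\<in>K. weakly_satisfies P D) \<longrightarrow>
        (\<exists>B :: ('f, 'p, 'a) struct.
           is_model (S0 \<union> E) (T0 \<union> form_of_clause ` K) B \<and>
           univ B = puniv P \<and> weak_embedding (S0 \<union> E) Pr id P B))"


section \<open>Extension terms\<close>

definition ext_terms :: "'f sig \<Rightarrow> ('f, 'p) clause \<Rightarrow> 'f trm set" where
  "ext_terms E D = {t\<in>subterms_clause D. \<exists>f ts. t = Fn f ts \<and> (f, length ts) \<in> E}"

definition vars_below :: "'f sig \<Rightarrow> ('f, 'p) clause set \<Rightarrow> bool" where
  "vars_below E K \<longleftrightarrow> (\<forall>D\<in>K. \<forall>x\<in>vars_clause D. \<exists>t\<in>ext_terms E D. x \<in> vars t)"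

definition flat :: "'f sig \<Rightarrow> ('f, 'p) clause set \<Rightarrow> bool" where
  "flat E K \<longleftrightarrow> (\<forall>D\<in>K. \<forall>f ts. Fn f ts \<in> ext_terms E D \<longrightarrow> (\<forall>t\<in>set ts. \<exists>x. t = Var x))"

definition linear :: "'f sig \<Rightarrow> ('f, 'p) clause set \<Rightarrow> bool" where
  "linear E K \<longleftrightarrow> (\<forall>D\<in>K.
     (\<forall>s\<in>ext_terms E D. \<forall>t\<in>ext_terms E D. vars s \<inter> vars t \<noteq> {} \<longrightarrow> s = t) \<and>
     (\<forall>t\<in>ext_terms E D. distinct (var_list t)))"

definition est :: "'f sig \<Rightarrow> ('f, 'p) clause set \<Rightarrow> ('f, 'p) clause set \<Rightarrow> 'f trm set" where
  "est E K G = {t\<in>(\<Union>D\<in>K \<union> G. ext_terms E D). vars t = {}}"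

text \<open>\<open>S\<close> is the signature of the ground terms that may be substituted.\<close>

definition instances ::
    "'f sig \<Rightarrow> 'f sig \<Rightarrow> 'f trm set \<Rightarrow> ('f, 'p) clause set \<Rightarrow> ('f, 'p) clause set" where
  "instances S E T K =
     {map_clause (subst \<sigma>) D | D \<sigma>. D \<in> K \<and>
        (\<forall>x\<in>vars_clause D. vars (\<sigma> x) = {} \<and> syms (\<sigma> x) \<subseteq> S) \<and>
        ext_terms E (map_clause (subst \<sigma>) D) \<subseteq> T}"


section \<open>Symbol elimination\<close>

text \<open>The map \<open>d\<close> sends a term \<open>t\<close> to the name of the constant that replaces it. Nullary symbols
  are constants already and are not renamed.\<close>

fun purify :: "'f sig \<Rightarrow> ('f trm \<Rightarrow> 'f) \<Rightarrow> 'f trm \<Rightarrow> 'f trm" where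
  "purify S1 d (Var x) = Var x"
| "purify S1 d (Fn f ts) =
     (if (f, length ts) \<in> S1 \<and> ts \<noteq> [] then Fn (d (Fn f ts)) []
      else Fn f (map (purify S1 d) ts))"

text \<open>The terms that get a definition: \<open>Fn f ts\<close> in this set stands for the definition
  \<open>d (Fn f ts) \<approx> f (purify ts)\<close>.\<close>

definition named_terms :: "'f sig \<Rightarrow> ('f, 'p) clause set \<Rightarrow> 'f trm set" where
  "named_terms S1 X = {t\<in>(\<Union>D\<in>X. ext_terms S1 D). \<forall>f. t \<noteq> Fn f []}"

definition con0 :: "'f sig \<Rightarrow> ('f trm \<Rightarrow> 'f) \<Rightarrow> 'f trm set \<Rightarrow> ('f, 'p) clause set" where
  "con0 S1 d N =
     {map2 (\<lambda>s t. Neg (Equ (purify S1 d s) (purify S1 d t))) ss ts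
        @ [Pos (Equ (Fn (d (Fn f ss)) []) (Fn (d (Fn f ts)) []))] | f ss ts.
      Fn f ss \<in> N \<and> Fn f ts \<in> N \<and> length ss = length ts}"

definition purified :: "'f sig \<Rightarrow> ('f trm \<Rightarrow> 'f) \<Rightarrow> ('f, 'p) clause set \<Rightarrow> ('f, 'p) clause set" where
  "purified S1 d X = map_clause (purify S1 d) ` X \<union> con0 S1 d (named_terms S1 X)"

text \<open>The constants in \<open>SC\<close> that are constant parameters or name a term headed by a parameter.\<close>

definition consts_f ::
    "'f sig \<Rightarrow> 'f sig \<Rightarrow> 'f sig \<Rightarrow> ('f trm \<Rightarrow> 'f) \<Rightarrow> ('f, 'p) clause set \<Rightarrow> 'f set" where
  "consts_f SC SigP S1 d X =
     {c. (c, 0) \<in> SC \<inter> SigP \<and> (\<exists>D\<in>purified S1 d X. (c, 0) \<in> syms_clause D)} \<union>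
     {d (Fn f ts) | f ts. Fn f ts \<in> named_terms S1 X \<and> (f, length ts) \<in> SigP}"

text \<open>The constants in \<open>SC\<close> that occur in an argument of a parameter in a definition.\<close>

definition consts_p ::
    "'f sig \<Rightarrow> 'f sig \<Rightarrow> 'f sig \<Rightarrow> ('f trm \<Rightarrow> 'f) \<Rightarrow> ('f, 'p) clause set \<Rightarrow> 'f set" where
  "consts_p SC SigP S1 d X =
     {c. (c, 0) \<in> SC \<and> (\<exists>f ts. Fn f ts \<in> named_terms S1 X \<and> (f, length ts) \<in> SigP \<and>
        (\<exists>s\<in>set ts. (c, 0) \<in> syms (purify S1 d s)))}"

definition consts_rest ::
    "'f sig \<Rightarrow> 'f sig \<Rightarrow> 'f sig \<Rightarrow> ('f trm \<Rightarrow> 'f) \<Rightarrow> ('f, 'p) clause set \<Rightarrow> 'f set" where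
  "consts_rest SC SigP S1 d X =
     {c. (c, 0) \<in> SC \<and> (\<exists>D\<in>purified S1 d X. (c, 0) \<in> syms_clause D)}
       - consts_f SC SigP S1 d X - consts_p SC SigP S1 d X"

definition consts_to_vars :: "'f set \<Rightarrow> ('f \<Rightarrow> nat) \<Rightarrow> ('f, 'p) fml \<Rightarrow> ('f, 'p) fml" where
  "consts_to_vars cs \<xi> \<phi> =
     map_form id (replace_consts (\<lambda>c. if c \<in> cs then Some (Var (\<xi> c)) else None)) \<phi>"

text \<open>\<open>\<Phi>\<close> is a possible output; the algorithm leaves open the choice of the fresh constants, of the
  variables, and of the result of quantifier elimination. \<open>E\<close> are the symbols that count as extension
  functions when \<open>K\<close> is instantiated: all of \<open>SigP \<union> Sig\<close> or, in a chain of extensions, only the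
  functions \<open>Sig\<close> added in the last step. Purification always concerns \<open>SigP \<union> Sig\<close>.

  The equation for \<open>\<theta>\<close> undoes the definitions of parameter terms exhaustively: with \<open>c \<approx> g(a)\<close> and
  \<open>d \<approx> g(c)\<close>, the constant \<open>d\<close> becomes \<open>g(g(a))\<close>. Accordingly a constant that is both an argument
  of a parameter and itself a parameter (term) is replaced by what it stands for, and not by one of
  the variables \<open>ys\<close>.\<close>

definition symbol_elimination ::
    "'a itself \<Rightarrow> 'f sig \<Rightarrow> 'p sig \<Rightarrow> 'f sig \<Rightarrow> 'f sig \<Rightarrow> 'f set \<Rightarrow> ('f, 'p) fml set \<Rightarrow> 'f sig \<Rightarrow>
     ('f, 'p) clause set \<Rightarrow> ('f, 'p) clause set \<Rightarrow> 'f trm set \<Rightarrow> ('f, 'p) fml \<Rightarrow> bool" where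
  "symbol_elimination A Sig0 Pr SigP Sig C T0 E K G T \<Phi> \<longleftrightarrow>
     finite T \<and>
     (\<exists>d Ds xs \<xi> \<Gamma>1 \<theta> \<Gamma>2 ys \<eta>.
       let S1 = SigP \<union> Sig;
           SC = C \<times> {0} \<union> S1;
           X = instances (Sig0 \<union> S1 \<union> C \<times> {0}) E T K \<union> G;
           N = named_terms S1 X;
           cf = consts_f SC SigP S1 d X;
           cp = consts_p SC SigP S1 d X;
           rest = consts_rest SC SigP S1 d X
       in
         inj_on d N \<and> (\<forall>t\<in>N. d t \<in> C \<and> (\<forall>D\<in>X. (d t, 0) \<notin> syms_clause D)) \<and>
         set Ds = purified S1 d X \<and>
         set xs = rest \<and> distinct xs \<and> inj_on \<xi> rest \<and>
         quantifier_free \<Gamma>1 \<and> fv \<Gamma>1 = {} \<and> over_form (Sig0 \<union> (cp \<union> cf) \<times> {0}) Pr \<Gamma>1 \<and>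
         equiv_mod A (Sig0 \<union> (cp \<union> cf) \<times> {0}) T0
           (foldr FEx (map \<xi> xs) (consts_to_vars rest \<xi> (conj_form Ds))) \<Gamma>1 \<and>
         dom \<theta> = {d (Fn f ts) | f ts. Fn f ts \<in> N \<and> (f, length ts) \<in> SigP} \<and>
         (\<forall>f ts. Fn f ts \<in> N \<and> (f, length ts) \<in> SigP \<longrightarrow>
            \<theta> (d (Fn f ts)) = Some (Fn f (map (\<lambda>s. replace_consts \<theta> (purify S1 d s)) ts))) \<and>
         \<Gamma>2 = map_form id (replace_consts \<theta>) \<Gamma>1 \<and>
         set ys = cp - cf \<and> distinct ys \<and> inj_on \<eta> (cp - cf) \<and>
         \<Phi> = foldr FAll (map \<eta> ys) (FNeg (consts_to_vars (cp - cf) \<eta> \<Gamma>2)))"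

end

theory Submission
  imports Defs
begin

text \<open>Suppose a model \<open>M\<close> of the base theory, of \<open>KP\<close> and of \<open>\<Gamma>\<close> violates the output formula at an
  assignment \<open>v\<close>. Interpreting each constant of the eliminated formula by the term or variable that
  replaced it, and the remaining constants by witnesses of the quantifiers, yields an expansion of \<open>M\<close>
  that satisfies the purified clauses. Let the symbols in \<open>Sig\<close> be defined exactly where a
  purified ground term prescribes a value; this is unambiguous by the congruence clauses. By flatness
  and linearity, any assignment that makes all terms of a clause of \<open>K1\<close> defined comes from an instance
  that was purified, so the partial structure satisfies \<open>K1\<close> weakly. Completing it by
  \<open>(Comp\<^sub>f)\<close> for the second extension contradicts unsatisfiability.\<close>

section \<open>Terms and evaluation\<close>

lemma subterms_refl: "t \<in> subterms t"
  by (cases t) auto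

lemma subterms_trans: "s \<in> subterms t \<Longrightarrow> t \<in> subterms u \<Longrightarrow> s \<in> subterms u"
  by (induction u) auto

lemma vars_subterm: "s \<in> subterms t \<Longrightarrow> vars s \<subseteq> vars t"
  by (induction t) auto

lemma syms_subterm: "s \<in> subterms t \<Longrightarrow> syms s \<subseteq> syms t"
  by (induction t) auto

lemma subst_cong: "(\<And>x. x \<in> vars t \<Longrightarrow> \<sigma> x = \<tau> x) \<Longrightarrow> subst \<sigma> t = subst \<tau> t"
  by (induction t) auto

lemma subst_ground: "vars t = {} \<Longrightarrow> subst \<sigma> t = t"
  by (induction t) (auto intro: map_idI)

lemma vars_subst: "vars (subst \<sigma> t) = (\<Union>x\<in>vars t. vars (\<sigma> x))"
  by (induction t) auto

lemma syms_subst: "syms (subst \<sigma> t) = syms t \<union> (\<Union>x\<in>vars t. syms (\<sigma> x))"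
  by (induction t) auto

lemma subterms_subst:
  "s \<in> subterms (subst \<sigma> t) \<Longrightarrow>
    (\<exists>x\<in>vars t. s \<in> subterms (\<sigma> x)) \<or> (\<exists>u\<in>subterms t. s = subst \<sigma> u)"
  by (induction t) (auto, metis)

lemma var_subterm_subst: "x \<in> vars t \<Longrightarrow> \<sigma> x \<in> subterms (subst \<sigma> t)"
  by (induction t) (auto intro: subterms_refl)

lemma eval_ground: "vars t = {} \<Longrightarrow> eval M v t = eval M w t"
  by (induction t) (auto cong: map_cong)

text \<open>Agreement is demanded only at the argument tuples that evaluating \<open>t\<close> in
  \<open>M\<close> actually visits. This lets it compare structures that differ at other tuples or
  at symbols absent from \<open>t\<close>.\<close>

lemma eval_cong:
  assumes "\<And>f ts. Fn f ts \<in> subterms t \<Longrightarrow> fn M f (map (eval M v) ts) = fn N f (map (eval M v) ts)"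
    and "\<And>x. x \<in> vars t \<Longrightarrow> v x = w x"
  shows "eval M v t = eval N w t"
  using assms
proof (induction t)
  case (Fn f ts)
  have "map (eval M v) ts = map (eval N w) ts"
  proof (intro map_cong refl Fn.IH)
    fix t assume t: "t \<in> set ts"
    then have sub: "subterms t \<subseteq> subterms (Fn f ts)" "vars t \<subseteq> vars (Fn f ts)" by auto
    show "fn M g (map (eval M v) us) = fn N g (map (eval M v) us)" if "Fn g us \<in> subterms t" for g us
      using that sub(1) by (intro Fn.prems(1)) blast
    show "v x = w x" if "x \<in> vars t" for x
      using that sub(2) by (intro Fn.prems(2)) blast
  qed
  then show ?case using Fn.prems(1)[of f ts] by (metis eval.simps(2) subterms_refl)
qed simp

lemma eval_in_univ:
  "is_struct S M \<Longrightarrow> range v \<subseteq> univ M \<Longrightarrow> syms t \<subseteq> S \<Longrightarrow> eval M v t \<in> univ M"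
proof (induction t)
  case (Fn f ts)
  then have "map (eval M v) ts \<in> tuples (univ M) (length ts)"
    by (auto simp: tuples_def)
  then show ?case using Fn.prems by (fastforce simp: is_struct_def)
qed auto

section \<open>Literals, clauses and quantifier prefixes\<close>

fun sat_lit :: "('f, 'p, 'a) struct \<Rightarrow> (nat \<Rightarrow> 'a) \<Rightarrow> ('p, 'f trm) lit \<Rightarrow> bool" where
  "sat_lit M v (Pos a) \<longleftrightarrow> sat_atom M v a"
| "sat_lit M v (Neg a) \<longleftrightarrow> \<not> sat_atom M v a"

lemma sat_form_of_clause: "sat M v (form_of_clause D) \<longleftrightarrow> (\<exists>l\<in>set D. sat_lit M v l)"
proof -
  have "sat M v (form_of_lit l) \<longleftrightarrow> sat_lit M v l" for l by (cases l) auto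
  then show ?thesis by (induction D) (auto simp: form_of_clause_def)
qed

lemma sat_conj_form: "sat M v (conj_form Ds) \<longleftrightarrow> (\<forall>D\<in>set Ds. sat M v (form_of_clause D))"
  by (induction Ds) (auto simp: conj_form_def)

lemma quantifier_free_conj_form: "quantifier_free (conj_form Ds)"
proof -
  have "quantifier_free (form_of_lit l)" for l :: "('p, 'f trm) lit" by (cases l) auto
  then have "quantifier_free (form_of_clause D)" for D :: "('f, 'p) clause"
    by (induction D) (auto simp: form_of_clause_def)
  then show ?thesis by (induction Ds) (auto simp: conj_form_def)
qed

text \<open>Unfolding the prefix collects the witnesses in one assignment. How \<open>w\<close>
  relates to \<open>v\<close> is not recorded: the purified terms evaluated later are ground and
  cannot tell the two apart.\<close>

lemma sat_foldr_FEx: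
  "sat M v (foldr FEx xs \<phi>) \<Longrightarrow> range v \<subseteq> univ M \<Longrightarrow> \<exists>w. range w \<subseteq> univ M \<and> sat M w \<phi>"
proof (induction xs arbitrary: v)
  case (Cons x xs)
  then obtain a where "a \<in> univ M" "sat M (v(x := a)) (foldr FEx xs \<phi>)" by auto
  then show ?case using Cons.IH[of "v(x := a)"] Cons.prems(2) by fastforce
qed auto

lemma holds_foldr_FAll: "holds M \<phi> \<Longrightarrow> holds M (foldr FAll xs \<phi>)"
proof (induction xs)
  case (Cons x xs)
  have "range (v(x := a)) \<subseteq> univ M" if "range v \<subseteq> univ M" "a \<in> univ M" for v a
    using that by auto
  then show ?case using Cons by (simp add: holds_def)
qed auto

lemma over_form_form_of_clause: "over_clause S Pr D \<Longrightarrow> over_form S Pr (form_of_clause D)"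
proof -
  have "terms_form (form_of_lit l) = terms_lit l" "psyms_form (form_of_lit l) = psyms_lit l"
    for l :: "('p, 'f trm) lit" by (cases l; simp)+
  note form_of_lit = this
  have "terms_form (form_of_clause D) = terms_clause D"
    "psyms_form (form_of_clause D) = (\<Union>l\<in>set D. psyms_lit l)"
    by (induction D) (auto simp: form_of_clause_def terms_clause_def form_of_lit)
  then show "over_clause S Pr D \<Longrightarrow> over_form S Pr (form_of_clause D)"
    by (auto simp: over_form_def over_clause_def syms_clause_def)
qed

lemma terms_clause_map: "terms_clause (map_clause h D) = h ` terms_clause D"
  by (auto simp: terms_clause_def map_clause_def lit.set_map)

lemma psyms_lit_map: "psyms_lit (map_lit id h l) = psyms_lit l"
proof -
  have "psyms_atom (map_atom id h a) = psyms_atom a" for a by (cases a) auto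
  then show ?thesis by (cases l) auto
qed

lemma ground_clause_terms: "ground_clause D \<longleftrightarrow> (\<forall>t\<in>terms_clause D. vars t = {})"
  by (auto simp: ground_clause_def vars_clause_def)

section \<open>Structures that agree on a signature\<close>

text \<open>Function values outside the universe carry no meaning in the record
  \<open>struct\<close>, so the comparison is confined to tuples over the universe, and to symbols
  at the arity listed in the signature.\<close>

definition agree :: "'f sig \<Rightarrow> 'p sig \<Rightarrow> ('f, 'p, 'a) struct \<Rightarrow> ('f, 'p, 'a) struct \<Rightarrow> bool" where
  "agree S Pr M N \<longleftrightarrow> univ M = univ N \<and>
     (\<forall>(f, n)\<in>S. \<forall>as\<in>tuples (univ M) n. fn M f as = fn N f as) \<and>
     (\<forall>(p, n)\<in>Pr. \<forall>as\<in>tuples (univ M) n. pr M p as = pr N p as)"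

lemma agreeD:
  assumes "agree S Pr M N"
  shows "univ N = univ M"
    and "(f, length as) \<in> S \<Longrightarrow> set as \<subseteq> univ M \<Longrightarrow> fn N f as = fn M f as"
    and "(p, length as) \<in> Pr \<Longrightarrow> set as \<subseteq> univ M \<Longrightarrow> pr N p as = pr M p as"
  using assms by (auto simp: agree_def tuples_def)

text \<open>Closure of \<open>M\<close> under \<open>S\<close> keeps every argument tuple inside the
  universe, which is where the agreement applies.\<close>

lemma agree_eval:
  assumes "agree S Pr M N" "is_struct S M" "range v \<subseteq> univ M" "syms t \<subseteq> S"
  shows "eval M v t = eval N v t"
proof (rule eval_cong)
  fix f ts assume sub: "Fn f ts \<in> subterms t"
  then have "syms (Fn f ts) \<subseteq> S" using syms_subterm assms(4) by blast
  then have "(f, length (map (eval M v) ts)) \<in> S" "\<forall>t\<in>set ts. syms t \<subseteq> S" by auto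
  moreover from this have "set (map (eval M v) ts) \<subseteq> univ M"
    using eval_in_univ[OF assms(2,3)] by auto
  ultimately show "fn M f (map (eval M v) ts) = fn N f (map (eval M v) ts)"
    using agreeD(2)[OF assms(1)] by metis
qed simp

lemma agree_sat:
  assumes "agree S Pr M N" "is_struct S M"
  shows "range v \<subseteq> univ M \<Longrightarrow> over_form S Pr \<phi> \<Longrightarrow> sat M v \<phi> \<longleftrightarrow> sat N v \<phi>"
proof (induction \<phi> arbitrary: v)
  case (FAtm a)
  have ev: "eval M v t = eval N v t" "eval M v t \<in> univ M" if "t \<in> terms_atom a" for t
    using that FAtm agree_eval[OF assms] eval_in_univ[OF assms(2)] by (auto simp: over_form_def)
  show ?case
  proof (cases a)
    case (Prd p ts)
    then have "map (eval M v) ts = map (eval N v) ts"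
      "set (map (eval M v) ts) \<subseteq> univ M" using ev by auto
    moreover have "(p, length (map (eval M v) ts)) \<in> Pr" using FAtm Prd by (simp add: over_form_def)
    ultimately show ?thesis using agreeD(3)[OF assms(1)] Prd by (metis sat.simps(2) sat_atom.simps(2))
  qed (use ev in auto)
next
  case (FAll x \<phi>)
  have "sat M (v(x := a)) \<phi> \<longleftrightarrow> sat N (v(x := a)) \<phi>" if "a \<in> univ M" for a
  proof (rule FAll.IH)
    show "range (v(x := a)) \<subseteq> univ M" using FAll.prems(1) that by (auto split: if_splits)
    show "over_form S Pr \<phi>" using FAll.prems(2) by (simp add: over_form_def)
  qed
  moreover have "univ N = univ M" using assms(1) by (simp add: agree_def)
  ultimately show ?case by simp
next
  case (FEx x \<phi>)
  have "sat M (v(x := a)) \<phi> \<longleftrightarrow> sat N (v(x := a)) \<phi>" if "a \<in> univ M" for a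
  proof (rule FEx.IH)
    show "range (v(x := a)) \<subseteq> univ M" using FEx.prems(1) that by (auto split: if_splits)
    show "over_form S Pr \<phi>" using FEx.prems(2) by (simp add: over_form_def)
  qed
  moreover have "univ N = univ M" using assms(1) by (simp add: agree_def)
  ultimately show ?case by simp
qed (simp_all add: over_form_def)

lemma agree_holds:
  "agree S Pr M N \<Longrightarrow> is_struct S M \<Longrightarrow> over_form S Pr \<phi> \<Longrightarrow> holds M \<phi> \<longleftrightarrow> holds N \<phi>"
  using agree_sat[of S Pr M N] by (auto simp: holds_def agree_def)

lemma agree_is_struct: "agree S Pr M N \<Longrightarrow> is_struct S M \<Longrightarrow> is_struct S N"
  by (fastforce simp: agree_def is_struct_def)

lemma agree_is_model:
  assumes "agree S Pr M N" "is_model S \<Phi> M" "\<forall>\<phi>\<in>\<Phi>. over_form S Pr \<phi>"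
  shows "is_model S \<Phi> N"
  using assms agree_holds agree_is_struct unfolding is_model_def by blast

lemma is_struct_mono: "is_struct S M \<Longrightarrow> S' \<subseteq> S \<Longrightarrow> is_struct S' M"
  unfolding is_struct_def by blast

lemma over_form_mono: "over_form S Pr \<phi> \<Longrightarrow> S \<subseteq> S' \<Longrightarrow> over_form S' Pr \<phi>"
  by (auto simp: over_form_def)

text \<open>The map \<open>h\<close> and the two assignments are arbitrary, so this covers both
  purifying a ground clause and instantiating a clause before purifying it. Values must lie in the
  universe because predicates are compared only there.\<close>

lemma sat_map_clause:
  assumes ev: "\<And>t. t \<in> terms_clause D \<Longrightarrow> eval M v t = eval N w (h t) \<and> eval M v t \<in> univ M"
    and pr: "\<And>p as. (p, length as) \<in> Pr \<Longrightarrow> set as \<subseteq> univ M \<Longrightarrow> pr M p as = pr N p as"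
    and over: "\<forall>l\<in>set D. psyms_lit l \<subseteq> Pr"
  shows "sat M v (form_of_clause D) \<longleftrightarrow> sat N w (form_of_clause (map_clause h D))"
proof -
  have lit: "sat_lit M v l \<longleftrightarrow> sat_lit N w (map_lit id h l)" if l: "l \<in> set D" for l
  proof -
    have ev_l: "eval M v t = eval N w (h t)" "eval M v t \<in> univ M" if "t \<in> terms_lit l" for t
      using that l ev by (auto simp: terms_clause_def)
    have "sat_atom M v a \<longleftrightarrow> sat_atom N w (map_atom id h a)" if a: "l = Pos a \<or> l = Neg a" for a
    proof (cases a)
      case (Prd p ts)
      then have "map (eval M v) ts = map (eval N w \<circ> h) ts" "set (map (eval M v) ts) \<subseteq> univ M"
        using a ev_l by auto
      moreover have "(p, length ts) \<in> Pr" using a Prd l over by auto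
      ultimately show ?thesis using Prd pr[of p "map (eval M v) ts"]
        by (metis atom.map(2) id_apply length_map map_map sat_atom.simps(2))
    qed (use a ev_l in auto)
    then show ?thesis by (cases l) auto
  qed
  then show ?thesis by (auto simp: sat_form_of_clause map_clause_def)
qed

section \<open>Reinterpreting constants\<close>

text \<open>Semantic counterpart of \<open>replace_consts\<close>. The replacing terms are evaluated
  in the old structure \<open>M\<close>, so the replacement is simultaneous; the test for an empty
  argument list leaves a symbol of the same name and positive arity untouched.\<close>

definition interpret_consts ::
    "(nat \<Rightarrow> 'a) \<Rightarrow> ('f \<rightharpoonup> 'f trm) \<Rightarrow> ('f, 'p, 'a) struct \<Rightarrow> ('f, 'p, 'a) struct" where
  "interpret_consts v \<theta> M = M\<lparr>fn := (\<lambda>f as. if as = [] then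
     (case \<theta> f of Some t \<Rightarrow> eval M v t | None \<Rightarrow> fn M f []) else fn M f as)\<rparr>"

lemma interpret_consts_simps [simp]:
  "univ (interpret_consts v \<theta> M) = univ M"
  "pr (interpret_consts v \<theta> M) = pr M"
  "as \<noteq> [] \<Longrightarrow> fn (interpret_consts v \<theta> M) f as = fn M f as"
  "\<theta> f = None \<Longrightarrow> fn (interpret_consts v \<theta> M) f as = fn M f as"
  "\<theta> f = Some t \<Longrightarrow> fn (interpret_consts v \<theta> M) f [] = eval M v t"
  by (auto simp: interpret_consts_def)

lemma eval_replace_consts: "eval M v (replace_consts \<theta> t) = eval (interpret_consts v \<theta> M) v t"
proof (induction t)
  case (Fn f ts)
  then have "map (eval M v \<circ> replace_consts \<theta>) ts = map (eval (interpret_consts v \<theta> M) v) ts" by simp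
  then show ?case by (cases "\<theta> f") (auto simp del: map_map simp: map_map[symmetric])
qed simp

text \<open>The replacing terms may contain variables, and
  \<open>interpret_consts v \<theta> M\<close> fixes their values by \<open>v\<close>. A quantifier
  would change the assignment, hence the restriction to quantifier-free formulae.\<close>

lemma sat_replace_consts:
  "quantifier_free \<phi> \<Longrightarrow>
    sat M v (map_form id (replace_consts \<theta>) \<phi>) \<longleftrightarrow> sat (interpret_consts v \<theta> M) v \<phi>"
proof (induction \<phi>)
  case (FAtm a)
  then show ?case by (cases a) (auto simp: eval_replace_consts comp_def)
qed auto

lemma quantifier_free_map_form: "quantifier_free (map_form g h \<phi>) = quantifier_free \<phi>"
  by (induction \<phi>) auto

section \<open>Mapped clauses and partial evaluation\<close>

lemma map_clause_comp: "map_clause g (map_clause h D) = map_clause (g \<circ> h) D"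
  by (simp add: map_clause_def lit.map_comp comp_def id_def)

lemma over_clause_map:
  "over_clause S Pr (map_clause h D) \<longleftrightarrow>
    (\<forall>t\<in>terms_clause D. syms (h t) \<subseteq> S) \<and> (\<forall>l\<in>set D. psyms_lit l \<subseteq> Pr)"
proof -
  have "(\<forall>l\<in>set (map_clause h D). psyms_lit l \<subseteq> Pr) \<longleftrightarrow> (\<forall>l\<in>set D. psyms_lit l \<subseteq> Pr)"
    by (simp add: map_clause_def psyms_lit_map)
  then show ?thesis unfolding over_clause_def syms_clause_def terms_clause_map by blast
qed

lemma subterms_clause_map:
  "subterms_clause (map_clause (subst \<sigma>) D) \<subseteq>
    subst \<sigma> ` subterms_clause D \<union> (\<Union>x\<in>vars_clause D. subterms (\<sigma> x))"
  by (fastforce simp: subterms_clause_def vars_clause_def terms_clause_map dest: subterms_subst)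

lemma vars_subterms_clause: "t \<in> subterms_clause D \<Longrightarrow> vars t \<subseteq> vars_clause D"
  unfolding subterms_clause_def vars_clause_def by (blast dest: vars_subterm)

lemma weak_embedding_id:
  assumes "weak_embedding S Pr id P B"
  shows "(f, length as) \<in> S \<Longrightarrow> set as \<subseteq> puniv P \<Longrightarrow> pfn P f as = Some b \<Longrightarrow> fn B f as = b"
    and "(p, length as) \<in> Pr \<Longrightarrow> set as \<subseteq> puniv P \<Longrightarrow> pr B p as = ppr P p as"
  using assms by (auto simp: weak_embedding_def tuples_def)

text \<open>Partial evaluation is strict: \<open>those\<close> yields \<open>None\<close> as soon as
  one argument is undefined. So a defined term of a clause makes all extension terms inside it
  defined.\<close>

lemma peval_subterm:
  "s \<in> subterms t \<Longrightarrow> peval P v t \<noteq> None \<Longrightarrow> peval P v s \<noteq> None"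
proof (induction t)
  case (Fn f ts)
  have "those xs = None" if "None \<in> set xs" for xs :: "'b option list"
    using that by (induction xs) (auto split: option.splits)
  moreover have "those (map (peval P v) ts) \<noteq> None"
    using Fn.prems(2) by (auto split: option.splits)
  ultimately have none: "None \<notin> peval P v ` set ts" by (metis set_map)
  have defined: "peval P v t \<noteq> None" if "t \<in> set ts" for t
    using none that by (metis imageI)
  show ?case
  proof (cases "s = Fn f ts")
    case False
    then obtain t where "t \<in> set ts" "s \<in> subterms t" using Fn.prems(1) by auto
    then show ?thesis using Fn.IH defined by blast
  qed (use Fn.prems in simp)
qed auto

lemma peval_flat: "peval P v (Fn f (map Var xs)) = pfn P f (map v xs)"
proof -
  have "those (map (\<lambda>x. Some (v x)) xs) = Some (map v xs)" by (induction xs) auto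
  then show ?thesis by (simp add: comp_def)
qed

section \<open>Purified ground clauses\<close>

text \<open>\<open>X\<close> stands for the instances of \<open>K1\<close> together with
  \<open>G\<close>; of their origin only groundness and the signature are kept. Freshness of the
  names is stated against the clauses of \<open>X\<close>, since other constants of \<open>C\<close>
  may occur there.\<close>

locale ground_purification =
  fixes Sig0 SigP Sig :: "'f sig" and Pr :: "'p sig" and C :: "'f set"
    and d :: "'f trm \<Rightarrow> 'f" and X :: "('f, 'p) clause set"
  assumes disjoint: "SigP \<inter> Sig0 = {}" "Sig \<inter> (Sig0 \<union> SigP) = {}"
      "C \<times> {0} \<inter> (Sig0 \<union> SigP \<union> Sig) = {}"
    and X: "\<And>D. D \<in> X \<Longrightarrow> ground_clause D \<and> over_clause (Sig0 \<union> SigP \<union> Sig \<union> C \<times> {0}) Pr D"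
    and inj_d: "inj_on d (named_terms (SigP \<union> Sig) X)"
    and fresh_d: "\<And>t D. t \<in> named_terms (SigP \<union> Sig) X \<Longrightarrow> d t \<in> C \<and> (D \<in> X \<longrightarrow> (d t, 0) \<notin> syms_clause D)"
begin

abbreviation "S1 \<equiv> SigP \<union> Sig"
abbreviation "SC \<equiv> C \<times> {0} \<union> S1"
abbreviation "pur \<equiv> purify S1 d"
abbreviation "N \<equiv> named_terms S1 X"
abbreviation "X' \<equiv> purified S1 d X"
abbreviation "cf \<equiv> consts_f SC SigP S1 d X"
abbreviation "cp \<equiv> consts_p SC SigP S1 d X"
abbreviation "rest \<equiv> consts_rest SC SigP S1 d X"

section \<open>Ground subterms and their purification\<close>

definition "SubX = (\<Union>D\<in>X. subterms_clause D)"
definition "consts_X' = {c. (c, 0) \<in> SC \<and> (\<exists>D\<in>X'. (c, 0) \<in> syms_clause D)}"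

lemma SubX_subterm: "s \<in> subterms t \<Longrightarrow> t \<in> SubX \<Longrightarrow> s \<in> SubX"
  by (auto simp: SubX_def subterms_clause_def intro: subterms_trans)

lemma SubX_arg: "Fn f ts \<in> SubX \<Longrightarrow> t \<in> set ts \<Longrightarrow> t \<in> SubX"
  by (rule SubX_subterm[of t "Fn f ts"]) (auto intro: subterms_refl)

lemma SubX_terms_clause: "D \<in> X \<Longrightarrow> t \<in> terms_clause D \<Longrightarrow> t \<in> SubX"
  by (auto simp: SubX_def subterms_clause_def intro: subterms_refl)

lemma SubX_E:
  assumes "t \<in> SubX"
  obtains D s where "D \<in> X" "s \<in> terms_clause D" "t \<in> subterms s"
  using assms by (auto simp: SubX_def subterms_clause_def)

lemma SubX_ground: "t \<in> SubX \<Longrightarrow> vars t = {}"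
  by (metis SubX_E X ground_clause_terms vars_subterm subset_empty)

lemma SubX_syms_clause: "t \<in> SubX \<Longrightarrow> \<exists>D\<in>X. syms t \<subseteq> syms_clause D"
  by (erule SubX_E) (unfold syms_clause_def, blast dest: syms_subterm)

lemma SubX_syms: "t \<in> SubX \<Longrightarrow> syms t \<subseteq> Sig0 \<union> SigP \<union> Sig \<union> C \<times> {0}"
  using SubX_syms_clause X unfolding over_clause_def by blast

lemma named_iff: "Fn f ts \<in> N \<longleftrightarrow> Fn f ts \<in> SubX \<and> (f, length ts) \<in> S1 \<and> ts \<noteq> []"
  by (auto simp: named_terms_def ext_terms_def SubX_def)

lemma named_ne: "t \<in> N \<Longrightarrow> d t \<noteq> c" if "Fn c [] \<in> SubX"
  using SubX_syms_clause[OF that] fresh_d by auto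

lemma purify_named: "Fn f ts \<in> N \<Longrightarrow> pur (Fn f ts) = Fn (d (Fn f ts)) []"
  by (simp add: named_iff)

lemma vars_purify: "vars (pur t) \<subseteq> vars t"
  by (induction t) auto

lemma purify_ground: "t \<in> SubX \<Longrightarrow> vars (pur t) = {}"
  using SubX_ground[of t] vars_purify[of t] by simp

text \<open>Constants form a case of their own, whatever signature they come from, because
  purification leaves nullary symbols alone. Symbols of \<open>C\<close> head no other terms, since
  they have arity 0.\<close>

lemma SubX_cases [consumes 1, case_names param ext base const]:
  assumes "Fn f ts \<in> SubX"
  obtains "Fn f ts \<in> N" "(f, length ts) \<in> SigP" "ts \<noteq> []"
  | "Fn f ts \<in> N" "(f, length ts) \<in> Sig" "ts \<noteq> []"
  | "(f, length ts) \<in> Sig0" "(f, length ts) \<notin> S1" "ts \<noteq> []"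
  | "ts = []" "(f, 0) \<in> Sig0 \<union> SC"
  using assms SubX_syms[OF assms] disjoint named_iff[of f ts] by (cases "ts = []") auto

lemma syms_purify: "t \<in> SubX \<Longrightarrow> syms (pur t) \<subseteq> Sig0 \<union> {(c, 0) | c. (c, 0) \<in> SC}"
proof (induction t)
  case (Fn f ts)
  have IH: "syms (pur t) \<subseteq> Sig0 \<union> {(c, 0) | c. (c, 0) \<in> SC}" if "t \<in> set ts" for t
    using Fn that SubX_arg by blast
  from Fn.prems show ?case
  proof (cases rule: SubX_cases)
    case base
    then have "syms (pur (Fn f ts)) = insert (f, length ts) (\<Union>t\<in>set ts. syms (pur t))" by simp
    moreover have "(\<Union>t\<in>set ts. syms (pur t)) \<subseteq> Sig0 \<union> {(c, 0) | c. (c, 0) \<in> SC}"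
      using IH by (rule UN_least)
    ultimately show ?thesis using base(1) by simp
  next
    case param
    then show ?thesis using fresh_d by (auto simp: purify_named simp del: purify.simps)
  next
    case ext
    then show ?thesis using fresh_d by (auto simp: purify_named simp del: purify.simps)
  qed auto
qed (use SubX_ground in force)

text \<open>The congruence clause of a named term with itself mentions the purified arguments.\<close>

lemma syms_purify_arg:
  assumes "Fn f ts \<in> N" "s \<in> set ts"
  shows "syms (pur s) \<subseteq> (\<Union>D\<in>X'. syms_clause D)"
proof -
  let ?D = "map2 (\<lambda>s t. Neg (Equ (pur s) (pur t))) ts ts @
    [Pos (Equ (Fn (d (Fn f ts)) []) (Fn (d (Fn f ts)) []))] :: ('f, 'p) clause"
  have "?D \<in> con0 S1 d N" unfolding con0_def using assms(1) by blast
  then have "?D \<in> X'" by (simp add: purified_def)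
  moreover have "Neg (Equ (pur s) (pur s)) \<in> set ?D"
    using assms(2) by (force simp: zip_same_conv_map)
  then have "pur s \<in> terms_clause ?D" unfolding terms_clause_def by force
  ultimately show ?thesis unfolding syms_clause_def by blast
qed

text \<open>Purification cuts a term off at its outermost named subterms, so symbols below them
  vanish from the purified clause. They reappear in the congruence clause of such a subterm with
  itself, and descending through the term recovers all of them.\<close>

lemma syms_purify_occurs: "t \<in> SubX \<Longrightarrow> syms (pur t) \<subseteq> (\<Union>D\<in>X'. syms_clause D)"
proof -
  let ?S = "\<Union>D\<in>X'. syms_clause D"
  have descend: "syms (pur u) \<subseteq> ?S" if "u \<in> subterms t" "t \<in> SubX" "syms (pur t) \<subseteq> ?S" for u t
    using that
  proof (induction t)
    case (Fn f ts)
    show ?case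
    proof (cases "u = Fn f ts")
      case False
      then obtain s where s: "s \<in> set ts" "u \<in> subterms s" using Fn.prems(1) by auto
      have "syms (pur s) \<subseteq> ?S"
      proof (cases "Fn f ts \<in> N")
        case True
        then show ?thesis using s syms_purify_arg by blast
      next
        case False
        then have "pur (Fn f ts) = Fn f (map pur ts)" by (simp add: Fn.prems(2) named_iff)
        then have "syms (pur s) \<subseteq> syms (pur (Fn f ts))" using s(1) by auto
        then show ?thesis using Fn.prems(3) by blast
      qed
      then show ?thesis using Fn.IH s SubX_arg[OF Fn.prems(2)] by blast
    qed (use Fn.prems in blast)
  qed simp
  show "t \<in> SubX \<Longrightarrow> syms (pur t) \<subseteq> ?S"
  proof -
    assume "t \<in> SubX"
    then obtain D s where D: "D \<in> X" "s \<in> terms_clause D" "t \<in> subterms s" by (rule SubX_E)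
    then have "map_clause pur D \<in> X'" by (auto simp: purified_def)
    moreover have "pur s \<in> terms_clause (map_clause pur D)" using D by (simp add: terms_clause_map)
    ultimately have "syms (pur s) \<subseteq> ?S" unfolding syms_clause_def by blast
    then show ?thesis by (rule descend[OF D(3) SubX_terms_clause[OF D(1,2)]])
  qed
qed

section \<open>Constants of the purified clauses\<close>

lemma syms_purify_consts: "t \<in> SubX \<Longrightarrow> syms (pur t) \<subseteq> Sig0 \<union> consts_X' \<times> {0}"
  using syms_purify[of t] syms_purify_occurs[of t] unfolding consts_X'_def by blast

text \<open>A constant in an argument of a parameter occurs in a reflexive congruence clause, so a
  constant parameter found there lands in \<open>cf\<close>. Hence neither the existential
  quantifiers nor the variables of the output formula ever take the place of a parameter.\<close>

lemma parameter_in_cf: "(c, 0) \<in> SigP \<Longrightarrow> c \<in> cp \<union> rest \<Longrightarrow> c \<in> cf"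
  using syms_purify_arg unfolding consts_f_def consts_p_def consts_rest_def by blast

lemma consts_X'_cases: "c \<in> consts_X' \<Longrightarrow> c \<in> cp \<union> cf \<union> rest"
  unfolding consts_X'_def consts_rest_def by blast

lemma cf_cases:
  assumes "c \<in> cf"
  obtains "(c, 0) \<in> SigP" | f ts where "c = d (Fn f ts)" "Fn f ts \<in> N" "(f, length ts) \<in> SigP"
  using assms unfolding consts_f_def by blast

lemma const_not_base: "(c, 0) \<in> SC \<Longrightarrow> (c, 0) \<notin> Sig0"
  using disjoint by auto

lemma name_not_sym: "t \<in> N \<Longrightarrow> (d t, 0) \<notin> Sig0 \<union> SigP \<union> Sig"
proof -
  assume "t \<in> N"
  then have "(d t, 0) \<in> C \<times> {0}" using fresh_d by simp
  then show ?thesis using disjoint(3) by blast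
qed

section \<open>Expanding a model of the eliminated formula\<close>

text \<open>The replacements made by the algorithm are undone in reverse order by three successive
  reinterpretations of constants. The last property ties the name of a parameter term to the
  function that \<open>M\<close> itself interprets.\<close>

lemma expansion:
  fixes M :: "('f, 'p, 'a) struct"
  assumes T0: "is_theory Sig0 Pr T0"
    and M: "is_model (Sig0 \<union> SigP) T0 M" and v: "range v \<subseteq> univ M"
    and Ds: "set Ds = X'" and xs: "set xs = rest"
    and \<Gamma>1: "quantifier_free \<Gamma>1"
      "equiv_mod TYPE('a) (Sig0 \<union> (cp \<union> cf) \<times> {0}) T0
        (foldr FEx (map \<xi> xs) (consts_to_vars rest \<xi> (conj_form Ds))) \<Gamma>1"
    and dom_\<theta>: "dom \<theta> = {d (Fn f ts) | f ts. Fn f ts \<in> N \<and> (f, length ts) \<in> SigP}"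
    and \<theta>: "\<And>f ts. Fn f ts \<in> N \<Longrightarrow> (f, length ts) \<in> SigP \<Longrightarrow>
      \<theta> (d (Fn f ts)) = Some (Fn f (map (\<lambda>s. replace_consts \<theta> (pur s)) ts))"
    and sat: "sat M v (consts_to_vars (cp - cf) \<eta> (map_form id (replace_consts \<theta>) \<Gamma>1))"
  obtains M' w where "univ M' = univ M" "pr M' = pr M" "range w \<subseteq> univ M"
    "\<And>f as. (f, length as) \<in> Sig0 \<union> SigP \<Longrightarrow> fn M' f as = fn M f as"
    "\<And>c. c \<in> consts_X' \<Longrightarrow> fn M' c [] \<in> univ M"
    "\<And>D. D \<in> X' \<Longrightarrow> sat M' w (form_of_clause D)"
    "\<And>f ts. Fn f ts \<in> N \<Longrightarrow> (f, length ts) \<in> SigP \<Longrightarrow>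
      fn M' (d (Fn f ts)) [] = fn M f (map (\<lambda>s. eval M' w (pur s)) ts)"
proof -
  \<comment> \<open>\<open>My\<close> gives the constants turned into universal variables their
    values under \<open>v\<close>; on top of it, \<open>M1\<close> gives the names of parameter
    terms the values of their terms in \<open>\<theta>\<close>. The order matters: those terms may
    still contain constants of \<open>cp - cf\<close>.\<close>
  define My where "My = interpret_consts v (\<lambda>c. if c \<in> cp - cf then Some (Var (\<eta> c)) else None) M"
  define M1 where "M1 = interpret_consts v \<theta> My"
  have sat1: "sat M1 v \<Gamma>1"
    using sat \<Gamma>1(1) unfolding M1_def My_def consts_to_vars_def
    by (simp add: sat_replace_consts quantifier_free_map_form)
  have univ1: "univ M1 = univ M" "pr M1 = pr M" by (simp_all add: M1_def My_def)
  have struct: "is_struct (Sig0 \<union> SigP) M" using M by (simp add: is_model_def)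
  have closed: "fn M f as \<in> univ M" if "(f, length as) \<in> Sig0 \<union> SigP" "set as \<subseteq> univ M" for f as
    using struct that unfolding is_struct_def tuples_def by blast
  have name_cf: "d (Fn f ts) \<in> cf" if "Fn f ts \<in> N" "(f, length ts) \<in> SigP" for f ts
    using that unfolding consts_f_def by blast
  have \<theta>_dom: "\<theta> c = None" if "\<And>f ts. Fn f ts \<in> N \<Longrightarrow> (f, length ts) \<in> SigP \<Longrightarrow> c \<noteq> d (Fn f ts)" for c
    using dom_\<theta> that by blast
  have M1_arg: "fn M1 f as = fn M f as" if "as \<noteq> []" for f as
    using that by (simp add: M1_def My_def)
  \<comment> \<open>The equation for \<open>\<theta>\<close> is recursive: its arguments
    \<open>replace_consts \<theta> (pur s)\<close>, evaluated in \<open>My\<close>, are the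
    \<open>pur s\<close> evaluated in \<open>M1\<close>. The head \<open>f\<close> has arguments, so
    it keeps its meaning from \<open>M\<close>.\<close>
  have M1_name: "fn M1 (d (Fn f ts)) [] = fn M f (map (\<lambda>s. eval M1 v (pur s)) ts)"
    if "Fn f ts \<in> N" "(f, length ts) \<in> SigP" for f ts
  proof -
    have "ts \<noteq> []" using that(1) by (simp add: named_iff)
    then show ?thesis
      using \<theta>[OF that] by (simp add: M1_def eval_replace_consts comp_def) (simp add: My_def)
  qed
  have M1_cp: "fn M1 c [] = v (\<eta> c)" if "c \<in> cp - cf" for c
  proof -
    have "\<theta> c = None" using name_cf that by (intro \<theta>_dom) blast
    then show ?thesis using that by (simp add: M1_def My_def)
  qed
  have M1_base: "fn M1 f as = fn M f as" if "(f, length as) \<in> Sig0 \<union> SigP" for f as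
  proof (cases "as = []")
    case True
    have "\<theta> f = None" using name_not_sym that True by (intro \<theta>_dom) auto
    moreover have "f \<notin> cp - cf"
    proof
      assume f: "f \<in> cp - cf"
      then have "(f, 0) \<in> SC" by (simp add: consts_p_def)
      then have "(f, 0) \<in> SigP" using const_not_base[of f] that True by simp
      then show False using parameter_in_cf f by blast
    qed
    ultimately show ?thesis using True by (simp add: M1_def My_def)
  qed (rule M1_arg)
  \<comment> \<open>\<open>M\<close> may send constants of \<open>C\<close> outside the universe, so
    closure is shown only for terms whose constants from \<open>SC\<close> lie in \<open>cp\<close>
    or \<open>cf\<close>. The induction runs over the unpurified term: a purified parameter term is
    a bare name, but its value depends on arguments, whose constants lie in
    \<open>cp\<close>.\<close>
  have M1_univ: "eval M1 v (pur t) \<in> univ M"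
    if "t \<in> SubX" "\<And>c. (c, 0) \<in> syms (pur t) \<Longrightarrow> (c, 0) \<in> SC \<Longrightarrow> c \<in> cp \<union> cf" for t
    using that
  proof (induction t)
    case (Fn f ts)
    from Fn.prems(1) show ?case
    proof (cases rule: SubX_cases)
      case param
      have "eval M1 v (pur s) \<in> univ M" if "s \<in> set ts" for s
      proof (rule Fn.IH)
        show "s \<in> SubX" using Fn.prems(1) that by (rule SubX_arg)
        show "c \<in> cp \<union> cf" if "(c, 0) \<in> syms (pur s)" "(c, 0) \<in> SC" for c
          using param \<open>s \<in> set ts\<close> that unfolding consts_p_def by blast
      qed (rule that)
      then have "fn M f (map (\<lambda>s. eval M1 v (pur s)) ts) \<in> univ M"
        using param by (intro closed) auto
      then show ?thesis using M1_name[OF param(1,2)] by (simp add: purify_named[OF param(1)] del: purify.simps)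
    next
      case ext
      let ?c = "d (Fn f ts)"
      have "(?c, 0) \<in> SC" using fresh_d[OF ext(1)] by simp
      then have "?c \<in> cp \<union> cf" using Fn.prems(2)[of ?c] by (simp add: purify_named[OF ext(1)] del: purify.simps)
      \<comment> \<open>By injectivity of \<open>d\<close> and disjointness of \<open>Sig\<close>
        and \<open>SigP\<close>, the name of a \<open>Sig\<close> term names no parameter term. It
        is thus one of the constants turned into universal variables.\<close>
      moreover have "?c \<notin> cf"
      proof
        assume "?c \<in> cf"
        then show False
        proof (cases rule: cf_cases)
          case 1
          then show ?thesis using name_not_sym[OF ext(1)] by simp
        next
          case (2 g us)
          then have "Fn f ts = Fn g us" using inj_d ext(1) by (auto dest: inj_onD)
          then show ?thesis using 2 ext disjoint(2) by auto
        qed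
      qed
      ultimately show ?thesis using M1_cp[of ?c] v by (auto simp: purify_named[OF ext(1)] simp del: purify.simps)
    next
      case base
      then have pur: "pur (Fn f ts) = Fn f (map pur ts)" by simp
      have "eval M1 v (pur s) \<in> univ M" if "s \<in> set ts" for s
      proof (rule Fn.IH)
        show "s \<in> SubX" using Fn.prems(1) that by (rule SubX_arg)
        show "c \<in> cp \<union> cf" if "(c, 0) \<in> syms (pur s)" "(c, 0) \<in> SC" for c
          using Fn.prems(2)[of c] that \<open>s \<in> set ts\<close> unfolding pur by auto
      qed (rule that)
      then have "fn M f (map (\<lambda>s. eval M1 v (pur s)) ts) \<in> univ M"
        using base by (intro closed) auto
      then show ?thesis using M1_base[of f] base by (simp add: pur comp_def)
    next
      case const
      show ?thesis
      proof (cases "(f, 0) \<in> Sig0 \<union> SigP")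
        case True
        then show ?thesis using closed[of f "[]"] M1_base[of f "[]"] const by simp
      next
        case False
        then have "f \<in> cp \<union> cf" using Fn.prems(2)[of f] const by simp
        moreover have "f \<notin> cf"
          using Fn.prems(1) const named_ne False by (auto elim!: cf_cases)
        ultimately have "fn M1 f [] = v (\<eta> f)" using M1_cp by blast
        then show ?thesis using const v by auto
      qed
    qed
  qed (use SubX_ground in force)
  have M1_consts: "fn M1 c [] \<in> univ M" if "c \<in> cp \<union> cf" for c
  proof (cases "c \<in> cf")
    case True
    then show ?thesis
    proof (cases rule: cf_cases)
      case 1
      then show ?thesis using closed[of c "[]"] M1_base[of c "[]"] by simp
    next
      case (2 f ts)
      have "eval M1 v (pur (Fn f ts)) \<in> univ M"
      proof (rule M1_univ)
        show "Fn f ts \<in> SubX" using 2(2) by (simp add: named_iff)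
        show "b \<in> cp \<union> cf" if "(b, 0) \<in> syms (pur (Fn f ts))" for b
          using that True 2(1) by (simp add: purify_named[OF 2(2)] del: purify.simps)
      qed
      then show ?thesis using 2(1) by (simp add: purify_named[OF 2(2)] del: purify.simps)
    qed
  next
    case False
    then show ?thesis using M1_cp that v by auto
  qed
  \<comment> \<open>The equivalence obtained by quantifier elimination is available only in models
    of \<open>T0\<close> over the base signature with the constants in \<open>cp\<close> and
    \<open>cf\<close>.\<close>
  have "is_model (Sig0 \<union> (cp \<union> cf) \<times> {0}) T0 M1"
  proof -
    have "is_struct (Sig0 \<union> (cp \<union> cf) \<times> {0}) M1"
      unfolding is_struct_def
    proof (intro conjI ballI, goal_cases)
      case 1
      then show ?case using struct by (simp add: univ1 is_struct_def)
    next
      case (2 fn')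
      obtain f n where fn': "fn' = (f, n)" by (cases fn')
      have "fn M1 f as \<in> univ M1" if "as \<in> tuples (univ M1) n" for as
      proof (cases "(f, n) \<in> Sig0")
        case True
        then show ?thesis using that M1_base[of f as] closed[of f as] by (simp add: tuples_def univ1)
      next
        case False
        then have "f \<in> cp \<union> cf" "as = []" using 2 that fn' by (auto simp: tuples_def)
        then show ?thesis using M1_consts univ1 by simp
      qed
      then show ?case by (simp add: fn')
    qed
    moreover have "agree Sig0 Pr M M1"
      using M1_base by (auto simp: agree_def univ1 tuples_def)
    then have "holds M1 \<phi>" if "\<phi> \<in> T0" for \<phi>
      using agree_holds[of Sig0 Pr M M1 \<phi>] is_struct_mono[OF struct] T0 M that
      by (auto simp: is_theory_def is_model_def)
    ultimately show ?thesis by (simp add: is_model_def)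
  qed
  then have "sat M1 v (foldr FEx (map \<xi> xs) (consts_to_vars rest \<xi> (conj_form Ds)))"
    using \<Gamma>1(2) sat1 v univ1 unfolding equiv_mod_def by blast
  then obtain w where w: "range w \<subseteq> univ M" "sat M1 w (consts_to_vars rest \<xi> (conj_form Ds))"
    using sat_foldr_FEx v univ1 by metis
  \<comment> \<open>The witnesses found for the existential variables become the values of the
    eliminated constants.\<close>
  define M2 where "M2 = interpret_consts w (\<lambda>c. if c \<in> rest then Some (Var (\<xi> c)) else None) M1"
  have M2_rest: "fn M2 c [] = w (\<xi> c)" if "c \<in> rest" for c
    using that by (simp add: M2_def)
  have M2_M1: "fn M2 c as = fn M1 c as" if "as \<noteq> [] \<or> c \<notin> rest" for c as
    using that by (auto simp: M2_def)
  show thesis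
  proof (rule that[of M2 w])
    show "univ M2 = univ M" "pr M2 = pr M" by (simp_all add: M2_def univ1)
    show "range w \<subseteq> univ M" by (rule w)
    show "fn M2 f as = fn M f as" if "(f, length as) \<in> Sig0 \<union> SigP" for f as
    proof -
      have "f \<notin> rest" if "as = []"
      proof
        assume f: "f \<in> rest"
        then have "(f, 0) \<in> SC" by (simp add: consts_rest_def)
        then have "(f, 0) \<in> SigP"
          using const_not_base[of f] \<open>(f, length as) \<in> Sig0 \<union> SigP\<close> that by simp
        then show False using parameter_in_cf f unfolding consts_rest_def by blast
      qed
      then show ?thesis using M1_base[OF that] M2_M1[of as f] by auto
    qed
    show "fn M2 c [] \<in> univ M" if "c \<in> consts_X'" for c
    proof (cases "c \<in> rest")
      case True
      then show ?thesis using w M2_rest by auto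
    next
      case False
      then show ?thesis using consts_X'_cases[OF that] M1_consts M2_M1[of "[]" c] by auto
    qed
    have "sat M2 w (conj_form Ds)"
      using w(2) unfolding consts_to_vars_def M2_def
      by (simp add: sat_replace_consts quantifier_free_conj_form)
    then show "sat M2 w (form_of_clause D)" if "D \<in> X'" for D
      using that Ds by (simp add: sat_conj_form)
    show "fn M2 (d (Fn f ts)) [] = fn M f (map (\<lambda>s. eval M2 w (pur s)) ts)"
      if "Fn f ts \<in> N" "(f, length ts) \<in> SigP" for f ts
    proof -
      \<comment> \<open>Constants from \<open>SC\<close> in arguments of parameters are in
        \<open>cp\<close>, hence not in \<open>rest\<close>, so passing to \<open>M2\<close> leaves
        the values of these arguments alone. The change from \<open>v\<close> to \<open>w\<close> is
        harmless because the purified terms are ground.\<close>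
      have "eval M1 w (pur s) = eval M2 w (pur s)" if s: "s \<in> set ts" for s
      proof (rule eval_cong)
        fix g us assume "Fn g us \<in> subterms (pur s)"
        then have g: "(g, length us) \<in> syms (pur s)" using syms_subterm by fastforce
        have "us \<noteq> [] \<or> g \<notin> rest"
        proof (rule ccontr)
          assume "\<not> ?thesis"
          then have g': "us = []" "g \<in> rest" by auto
          then have "(g, 0) \<in> SC" "(g, 0) \<in> syms (pur s)" using g by (auto simp: consts_rest_def)
          then have "g \<in> cp"
            unfolding consts_p_def using s \<open>Fn f ts \<in> N\<close> \<open>(f, length ts) \<in> SigP\<close> by blast
          then show False using g' by (simp add: consts_rest_def)
        qed
        then show "fn M1 g (map (eval M1 w) us) = fn M2 g (map (eval M1 w) us)"
          using M2_M1[of "map (eval M1 w) us" g] by simp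
      qed simp
      moreover have "eval M1 w (pur s) = eval M1 v (pur s)" if s: "s \<in> set ts" for s
        using \<open>Fn f ts \<in> N\<close> s SubX_arg by (intro eval_ground purify_ground) (auto simp: named_iff)
      ultimately have "map (\<lambda>s. eval M1 v (pur s)) ts = map (\<lambda>s. eval M2 w (pur s)) ts" by simp
      moreover have "d (Fn f ts) \<notin> rest" using name_cf[OF that] by (simp add: consts_rest_def)
      ultimately show ?thesis using M1_name[OF that] M2_M1[of "[]" "d (Fn f ts)"] by metis
    qed
  qed
qed

section \<open>Completing the partial structure of named terms\<close>

text \<open>\<open>SubX\<close> is closed under subterms, so a structure that respects the valuation
  \<open>ev\<close> there allows the substitution to be shifted into the assignment. This serves the
  partial structure and, with the identity substitution, its completion.\<close>

lemma eval_of_ground_values: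
  assumes "\<And>f ts. Fn f ts \<in> SubX \<Longrightarrow> fn S f (map ev ts) = ev (Fn f ts)"
  shows "subst \<sigma> u \<in> SubX \<Longrightarrow> (\<And>x. x \<in> vars u \<Longrightarrow> v x = ev (\<sigma> x)) \<Longrightarrow> eval S v u = ev (subst \<sigma> u)"
proof (induction u)
  case (Fn f us)
  have "eval S v u = ev (subst \<sigma> u)" if "u \<in> set us" for u
  proof (rule Fn.IH)
    show "subst \<sigma> u \<in> SubX" using that Fn.prems(1) SubX_arg by simp
    show "v x = ev (\<sigma> x)" if "x \<in> vars u" for x
      using Fn.prems(2)[of x] that \<open>u \<in> set us\<close> by auto
  qed (rule that)
  then have "map (eval S v) us = map ev (map (subst \<sigma>) us)" by simp
  moreover have "fn S f (map ev (map (subst \<sigma>) us)) = ev (subst \<sigma> (Fn f us))"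
    using assms[of f "map (subst \<sigma>) us"] Fn.prems(1) by simp
  ultimately show ?case by (metis eval.simps(2))
qed simp

text \<open>In \<open>M'\<close> the \<open>Sig\<close> terms are represented only by their names;
  here functions are built from the values of these names. Agreement of \<open>B\<close> with
  \<open>M\<close> is part of the result so that a formula over base and parameter symbols can be
  carried over afterwards.\<close>

lemma completion:
  fixes M :: "('f, 'p, 'a) struct"
  assumes M: "is_model (Sig0 \<union> SigP) (T0 \<union> form_of_clause ` KP) M"
    and over: "\<forall>\<phi>\<in>T0 \<union> form_of_clause ` KP. over_form (Sig0 \<union> SigP) Pr \<phi>"
    and K1: "\<forall>D\<in>K1. over_clause (Sig0 \<union> SigP \<union> Sig) Pr D"
    and comp: "comp_f TYPE('a) (Sig0 \<union> SigP) Sig Pr (T0 \<union> form_of_clause ` KP) K1"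
    and below: "vars_below Sig K1" and E: "Sig \<subseteq> E"
    and flat_linear: "flat E K1" "linear E K1"
    and X_eq: "X = instances (Sig0 \<union> S1 \<union> C \<times> {0}) E (est E K1 G) K1 \<union> G"
    and fin: "finite (est E K1 G)"
    and M': "univ M' = univ M" "pr M' = pr M" and w: "range w \<subseteq> univ M"
    and M'_base: "\<And>f as. (f, length as) \<in> Sig0 \<union> SigP \<Longrightarrow> fn M' f as = fn M f as"
    and M'_consts: "\<And>c. c \<in> consts_X' \<Longrightarrow> fn M' c [] \<in> univ M"
    and M'_X: "\<And>D. D \<in> X' \<Longrightarrow> sat M' w (form_of_clause D)"
    and M'_name: "\<And>f ts. Fn f ts \<in> N \<Longrightarrow> (f, length ts) \<in> SigP \<Longrightarrow>
      fn M' (d (Fn f ts)) [] = fn M f (map (\<lambda>s. eval M' w (pur s)) ts)"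
  obtains B where "agree (Sig0 \<union> SigP) Pr M B"
    "is_model (Sig0 \<union> SigP \<union> Sig \<union> C \<times> {0})
      (T0 \<union> form_of_clause ` KP \<union> form_of_clause ` K1 \<union> form_of_clause ` G) B"
proof -
  define ev where "ev t = eval M' w (pur t)" for t
  have map_ev: "map ev ts = map (\<lambda>s. eval M' w (pur s)) ts" for ts by (simp add: ev_def)
  let ?T = "est E K1 G"
  have struct: "is_struct (Sig0 \<union> SigP) M" using M by (simp add: is_model_def)
  have closed: "fn M f as \<in> univ M" if "(f, length as) \<in> Sig0 \<union> SigP" "set as \<subseteq> univ M" for f as
    using struct that unfolding is_struct_def tuples_def by blast
  \<comment> \<open>The signature lists just the constants of the purified clauses, as an arbitrary
    constant of \<open>C\<close> may have a value outside the universe. By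
    \<open>syms_purify_consts\<close> it covers every \<open>pur t\<close>.\<close>
  have "is_struct (Sig0 \<union> consts_X' \<times> {0}) M'"
    unfolding is_struct_def
  proof (intro conjI ballI, goal_cases)
    case 1
    then show ?case using struct by (simp add: M' is_struct_def)
  next
    case (2 fn')
    obtain f n where fn': "fn' = (f, n)" by (cases fn')
    have "fn M' f as \<in> univ M'" if as: "as \<in> tuples (univ M') n" for as
    proof (cases "(f, n) \<in> Sig0")
      case True
      then show ?thesis using as M'_base[of f as] closed[of f as] by (simp add: tuples_def M')
    next
      case False
      then have "f \<in> consts_X'" "as = []" using 2 as fn' by (auto simp: tuples_def)
      then show ?thesis using M'_consts M' by simp
    qed
    then show ?case by (simp add: fn')
  qed
  then have ev_univ: "ev t \<in> univ M" if "t \<in> SubX" for t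
    unfolding ev_def using eval_in_univ[of "Sig0 \<union> consts_X' \<times> {0}" M' w "pur t"]
      syms_purify_consts[OF that] w M' by simp
  have ev_args: "set (map ev ts) \<subseteq> univ M" if "Fn f ts \<in> SubX" for f ts
    using ev_univ SubX_arg[OF that] by auto
  have ev_base: "ev (Fn f ts) = fn M f (map ev ts)"
    if t: "Fn f ts \<in> SubX" and f: "(f, length ts) \<in> Sig0 \<union> SigP" for f ts
    using t
  proof (cases rule: SubX_cases)
    case param
    then show ?thesis using M'_name[OF param(1,2)]
      unfolding map_ev by (simp add: ev_def purify_named[OF param(1)] del: purify.simps)
  next
    case ext
    then show ?thesis using f disjoint by auto
  next
    case base
    then show ?thesis using M'_base[of f "map ev ts"] unfolding map_ev by (simp add: ev_def comp_def)
  next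
    case const
    then show ?thesis using f M'_base[of f "[]"] by (simp add: ev_def)
  qed
  \<comment> \<open>If two \<open>Sig\<close> terms have arguments of equal value, all negative
    literals of their congruence clause are false, so the clause identifies their names. For
    constants both argument lists are empty and the terms coincide.\<close>
  have ev_cong: "ev (Fn f ss) = ev (Fn f ts)"
    if "Fn f ss \<in> SubX" "Fn f ts \<in> SubX" "(f, length ts) \<in> Sig" "map ev ss = map ev ts" for f ss ts
  proof (cases "ts = []")
    case False
    have len: "length ss = length ts" using that(4) by (metis length_map)
    have named: "Fn f ss \<in> N" "Fn f ts \<in> N" using that len False by (auto simp: named_iff)
    let ?D = "map2 (\<lambda>s t. Neg (Equ (pur s) (pur t))) ss ts
      @ [Pos (Equ (Fn (d (Fn f ss)) []) (Fn (d (Fn f ts)) []))]"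
    have "?D \<in> X'" unfolding purified_def con0_def using named len by blast
    then have "sat M' w (form_of_clause ?D)" by (rule M'_X)
    moreover have "ev (fst st) = ev (snd st)" if "st \<in> set (zip ss ts)" for st
      using that \<open>map ev ss = map ev ts\<close> len by (metis in_set_zip length_map nth_map)
    ultimately have "eval M' w (Fn (d (Fn f ss)) []) = eval M' w (Fn (d (Fn f ts)) [])"
      by (fastforce simp: sat_form_of_clause ev_def)
    then show ?thesis unfolding ev_def purify_named[OF named(1)] purify_named[OF named(2)] .
  qed (use that in simp)
  \<comment> \<open>A \<open>Sig\<close> function is defined exactly at the argument values of
    ground terms in \<open>SubX\<close>; by \<open>ev_cong\<close> the chosen representative does
    not matter. All other symbols, including names and constants of \<open>C\<close>, keep their
    meaning from \<open>M'\<close>.\<close>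
  define P :: "('f, 'p, 'a) pstruct" where
    "P = \<lparr>puniv = univ M, pfn = (\<lambda>f as. if (f, length as) \<in> Sig
        then (if \<exists>ts. Fn f ts \<in> SubX \<and> map ev ts = as
          then Some (ev (Fn f (SOME ts. Fn f ts \<in> SubX \<and> map ev ts = as))) else None)
        else Some (fn M' f as)), ppr = pr M\<rparr>"
  have P_simps: "puniv P = univ M" "ppr P = pr M" "univ (totalize P) = univ M" "pr (totalize P) = pr M"
    by (simp_all add: P_def totalize_def)
  have P_ext: "pfn P f (map ev ts) = Some (ev (Fn f ts))"
    if "Fn f ts \<in> SubX" "(f, length ts) \<in> Sig" for f ts
  proof -
    let ?us = "SOME us. Fn f us \<in> SubX \<and> map ev us = map ev ts"
    have "Fn f ?us \<in> SubX \<and> map ev ?us = map ev ts"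
      by (rule someI[of _ ts]) (use that in simp)
    then have "ev (Fn f ?us) = ev (Fn f ts)" using ev_cong that by blast
    then show ?thesis using that by (auto simp: P_def)
  qed
  have P_ext_ex: "\<exists>ts. Fn f ts \<in> SubX \<and> map ev ts = as"
    if "(f, length as) \<in> Sig" "pfn P f as \<noteq> None" for f as
    using that by (auto simp: P_def split: if_splits)
  have P_other: "pfn P f as = Some (fn M' f as)" if "(f, length as) \<notin> Sig" for f as
    using that by (simp add: P_def)
  have P_base: "pfn P f as = Some (fn M f as)" if "(f, length as) \<in> Sig0 \<union> SigP" for f as
    using P_other[of f as] M'_base[OF that] that disjoint by auto
  have totalize_ev: "fn (totalize P) f (map ev ts) = ev (Fn f ts)" if "Fn f ts \<in> SubX" for f ts
  proof (cases "(f, length ts) \<in> Sig")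
    case True
    then show ?thesis using P_ext that by (simp add: totalize_def)
  next
    case not_ext: False
    show ?thesis
    proof (cases "(f, length ts) \<in> Sig0 \<union> SigP")
      case True
      then show ?thesis using P_base[of f "map ev ts"] ev_base that by (simp add: totalize_def)
    next
      case False
      then have "(f, length ts) \<in> C \<times> {0}" using not_ext SubX_syms[OF that] by auto
      then have "ts = []" by auto
      then show ?thesis using P_other[of f "[]"] not_ext by (simp add: totalize_def ev_def)
    qed
  qed
  \<comment> \<open>Ground extension terms of \<open>G\<close> are in the instantiation set by
    definition of \<open>est\<close>, those of the instances by the condition on admissible
    instances. This bounds the domains of definition and helps to show that the instance built below
    is admissible.\<close>
  have X_ext: "t \<in> ?T" if t: "Fn f ts \<in> SubX" "(f, length ts) \<in> E" "t = Fn f ts" for t f ts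
  proof -
    obtain D where D: "D \<in> X" "t \<in> subterms_clause D" using t by (auto simp: SubX_def)
    then have t_ext: "t \<in> ext_terms E D" using t by (auto simp: ext_terms_def)
    from D(1) consider "D \<in> G" | D' \<sigma> where "D = map_clause (subst \<sigma>) D'" "ext_terms E D \<subseteq> ?T"
      unfolding X_eq instances_def by blast
    then show ?thesis
    proof cases
      case 1
      then show ?thesis using t_ext SubX_ground[OF t(1)] t(3) by (auto simp: est_def simp del: var_list.simps)
    qed (use t_ext in blast)
  qed
  have agree_P: "agree (Sig0 \<union> SigP) Pr M (totalize P)"
    using P_base by (auto simp: agree_def tuples_def P_simps) (auto simp: totalize_def)
  have weak: "weakly_satisfies P D" if D: "D \<in> K1" for D
    unfolding weakly_satisfies_def
  proof (intro allI impI)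
    fix v assume v: "range v \<subseteq> puniv P" and defined: "\<forall>t\<in>terms_clause D. peval P v t \<noteq> None"
    \<comment> \<open>By flatness \<open>t\<close> is \<open>f\<close> applied to variables, so its
      being defined under \<open>v\<close> exhibits a ground term \<open>Fn f ts\<close> in
      \<open>SubX\<close> with the same argument values. By linearity the variables are distinct, so
      they can be mapped to the entries of \<open>ts\<close>.\<close>
    have matching: "\<exists>\<tau>. subst \<tau> t \<in> SubX \<and> (\<forall>x\<in>vars t. v x = ev (\<tau> x))" if t: "t \<in> ext_terms Sig D" for t
    proof -
      obtain f us where t_eq: "t = Fn f us" and f: "(f, length us) \<in> Sig" and sub: "t \<in> subterms_clause D"
        using t by (auto simp: ext_terms_def)
      have t_E: "t \<in> ext_terms E D" using t E by (auto simp: ext_terms_def)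
      then have "\<forall>u\<in>set us. \<exists>x. u = Var x" using flat_linear(1) D unfolding flat_def t_eq by blast
      then obtain xs where xs: "us = map Var xs" by (metis ex_map_conv)
      have "concat (map (\<lambda>x. [x]) xs) = xs" by (induction xs) auto
      then have var_list: "var_list t = xs" by (simp add: t_eq xs comp_def)
      then have dist: "distinct xs" using flat_linear(2) D t_E unfolding linear_def by blast
      obtain s where "s \<in> terms_clause D" "t \<in> subterms s"
        using sub by (auto simp: subterms_clause_def)
      then have "peval P v t \<noteq> None" using defined peval_subterm[of t s P v] by simp
      then have "pfn P f (map v xs) \<noteq> None" unfolding t_eq xs peval_flat .
      then obtain ts where ts: "Fn f ts \<in> SubX" "map ev ts = map v xs"
        using P_ext_ex[of f "map v xs"] f xs by auto
      then have len: "length ts = length xs" by (metis length_map)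
      define \<tau> where "\<tau> x = the (map_of (zip xs ts) x)" for x
      have \<tau>: "\<tau> (xs ! i) = ts ! i" if "i < length xs" for i
        using that len dist by (simp add: \<tau>_def map_of_zip_nth)
      have "subst \<tau> t = Fn f ts" using \<tau> len by (auto simp: t_eq xs intro!: nth_equalityI)
      moreover have "v x = ev (\<tau> x)" if "x \<in> vars t" for x
      proof -
        obtain i where "i < length xs" "x = xs ! i"
          using \<open>x \<in> vars t\<close> unfolding var_list by (auto simp: in_set_conv_nth)
        then show ?thesis using ts(2) \<tau> len by (metis nth_map)
      qed
      ultimately show ?thesis using ts(1) by (intro exI[of _ \<tau>]) simp
    qed
    define \<tau> where "\<tau> t = (SOME \<tau>. subst \<tau> t \<in> SubX \<and> (\<forall>x\<in>vars t. v x = ev (\<tau> x)))" for t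
    have \<tau>: "subst (\<tau> t) t \<in> SubX" "\<And>x. x \<in> vars t \<Longrightarrow> v x = ev (\<tau> t x)" if "t \<in> ext_terms Sig D" for t
      using someI_ex[OF matching[OF that]] unfolding \<tau>_def by blast+
    \<comment> \<open>Linearity puts each variable into a single extension term, so the matchings of
      the separate terms can be glued without conflict.\<close>
    define \<sigma> where "\<sigma> x = \<tau> (SOME t. t \<in> ext_terms Sig D \<and> x \<in> vars t) x" for x
    have unique: "s = t" if "s \<in> ext_terms E D" "t \<in> ext_terms E D" "x \<in> vars s" "x \<in> vars t" for s t x
      using flat_linear(2) D that unfolding linear_def by blast
    have ext_E: "t \<in> ext_terms E D" if "t \<in> ext_terms Sig D" for t
      using that E by (auto simp: ext_terms_def)
    have \<sigma>_eq: "\<sigma> x = \<tau> t x" if "t \<in> ext_terms Sig D" "x \<in> vars t" for t x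
    proof -
      let ?s = "SOME t. t \<in> ext_terms Sig D \<and> x \<in> vars t"
      have "?s \<in> ext_terms Sig D \<and> x \<in> vars ?s" by (rule someI[of _ t]) (use that in simp)
      then show ?thesis using unique[of ?s t x] ext_E that by (auto simp: \<sigma>_def)
    qed
    have \<sigma>_ext: "subst \<sigma> t \<in> SubX" if "t \<in> ext_terms Sig D" for t
      using \<tau>(1)[OF that] \<sigma>_eq[OF that] subst_cong[of t \<sigma> "\<tau> t"] by simp
    have below_D: "\<exists>t\<in>ext_terms Sig D. x \<in> vars t" if "x \<in> vars_clause D" for x
      using below[unfolded vars_below_def, rule_format, OF D that] .
    have \<sigma>: "\<sigma> x \<in> SubX \<and> v x = ev (\<sigma> x)" if "x \<in> vars_clause D" for x
    proof -
      obtain t where t: "t \<in> ext_terms Sig D" "x \<in> vars t"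
        using below_D \<open>x \<in> vars_clause D\<close> by blast
      have "\<sigma> x \<in> SubX"
        by (rule SubX_subterm[OF var_subterm_subst[OF t(2)] \<sigma>_ext[OF t(1)]])
      then show ?thesis using \<tau>(2)[OF t] \<sigma>_eq[OF t] by simp
    qed
    let ?D = "map_clause (subst \<sigma>) D"
    have "ext_terms E ?D \<subseteq> ?T"
    proof
      fix s assume "s \<in> ext_terms E ?D"
      then obtain f ts where s: "s \<in> subterms_clause ?D" "s = Fn f ts" "(f, length ts) \<in> E"
        by (auto simp: ext_terms_def)
      then consider x where "x \<in> vars_clause D" "s \<in> subterms (\<sigma> x)"
        | u where "u \<in> subterms_clause D" "s = subst \<sigma> u"
        using subsetD[OF subterms_clause_map s(1)] by blast
      then show "s \<in> ?T"
      proof cases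
        case 1
        then have "s \<in> SubX" using \<sigma> SubX_subterm by blast
        then show ?thesis using X_ext s by blast
      next
        case 2
        show ?thesis
        proof (cases u)
          case (Var x)
          then have "x \<in> vars_clause D"
            using vars_subterms_clause[OF 2(1)] Var by simp
          then show ?thesis using X_ext[of f ts s] s \<sigma>[of x] 2(2) Var by simp
        next
          case (Fn g us)
          then have u: "u \<in> ext_terms E D" using 2 s by (auto simp: ext_terms_def)
          show ?thesis
          proof (cases "vars u = {}")
            case True
            then show ?thesis using u D 2(2) subst_ground[OF True, of \<sigma>] by (auto simp: est_def)
          next
            case False
            \<comment> \<open>Each variable of \<open>D\<close> lies below a \<open>Sig\<close>
              symbol. Linearity with respect to \<open>E\<close> forces \<open>u\<close> to be that
              \<open>Sig\<close> term, even when \<open>E\<close> also contains the parameters, and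
              the instance of a \<open>Sig\<close> term is in \<open>SubX\<close>.\<close>
            then obtain x where x: "x \<in> vars u" by (metis ex_in_conv)
            then have "x \<in> vars_clause D"
              using vars_subterms_clause[OF 2(1)] by blast
            then obtain t where t: "t \<in> ext_terms Sig D" "x \<in> vars t"
              using below_D by blast
            then have "u \<in> ext_terms Sig D" using unique[OF u ext_E[OF t(1)] x t(2)] by simp
            then show ?thesis using X_ext[of f ts s] s 2(2) \<sigma>_ext[of u] by simp
          qed
        qed
      qed
    qed
    moreover have "vars (\<sigma> x) = {} \<and> syms (\<sigma> x) \<subseteq> Sig0 \<union> S1 \<union> C \<times> {0}" if "x \<in> vars_clause D" for x
      using \<sigma>[OF that] SubX_ground[of "\<sigma> x"] SubX_syms[of "\<sigma> x"] by (auto simp del: var_list.simps)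
    ultimately have D_X: "?D \<in> X" unfolding X_eq instances_def using D by blast
    have eval_D: "eval (totalize P) v t = eval M' w ((pur \<circ> subst \<sigma>) t) \<and> eval (totalize P) v t \<in> univ (totalize P)"
      if t: "t \<in> terms_clause D" for t
    proof -
      have sub: "subst \<sigma> t \<in> SubX" using D_X t SubX_terms_clause by (simp add: terms_clause_map)
      have "v x = ev (\<sigma> x)" if "x \<in> vars t" for x
        using \<sigma> that t unfolding vars_clause_def by blast
      then have "eval (totalize P) v t = ev (subst \<sigma> t)"
        using eval_of_ground_values[of "totalize P" ev \<sigma> t v] totalize_ev sub by blast
      then show ?thesis using ev_univ[OF sub] by (simp add: ev_def P_simps)
    qed
    \<comment> \<open>The values under \<open>v\<close> are those of the substituted ground terms,
      so the truth of \<open>D\<close> in the partial structure is the truth of a purified instance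
      in \<open>M'\<close>.\<close>
    have "sat (totalize P) v (form_of_clause D)
        \<longleftrightarrow> sat M' w (form_of_clause (map_clause (pur \<circ> subst \<sigma>) D))"
      using K1 D by (intro sat_map_clause[where Pr = Pr, OF eval_D]) (auto simp: P_simps M' over_clause_def)
    moreover have "map_clause pur ?D \<in> X'" using D_X by (simp add: purified_def)
    ultimately show "sat (totalize P) v (form_of_clause D)"
      using M'_X by (simp add: map_clause_comp)
  qed
  obtain B :: "('f, 'p, 'a) struct" where
    B: "is_model (Sig0 \<union> SigP \<union> Sig) (T0 \<union> form_of_clause ` KP \<union> form_of_clause ` K1) B"
    "univ B = puniv P" "weak_embedding (Sig0 \<union> SigP \<union> Sig) Pr id P B"
  proof -
    have "is_pstruct (Sig0 \<union> SigP \<union> Sig) P"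
      unfolding is_pstruct_def
    proof (intro conjI ballI, goal_cases)
      case 1
      then show ?case using struct by (simp add: P_simps is_struct_def)
    next
      case (2 fn')
      obtain f n where fn': "fn' = (f, n)" by (cases fn')
      have "b \<in> puniv P" if as: "as \<in> tuples (puniv P) n" and b: "pfn P f as = Some b" for as b
      proof (cases "(f, n) \<in> Sig")
        case True
        then have f: "(f, length as) \<in> Sig" using as by (simp add: tuples_def)
        then obtain ts where ts: "Fn f ts \<in> SubX" "map ev ts = as" using P_ext_ex b by blast
        then show ?thesis using P_ext[OF ts(1)] f b ev_univ by (auto simp: P_simps)
      next
        case False
        then show ?thesis using as b 2 fn' closed[of f as] P_base[of f as] by (auto simp: P_simps tuples_def)
      qed
      then show ?case by (simp add: fn')
    qed
    moreover have "\<forall>(f, n)\<in>Sig0 \<union> SigP. fun_dom P f n = tuples (puniv P) n"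
      using P_base by (auto simp: fun_dom_def tuples_def)
    moreover have "is_model (Sig0 \<union> SigP) (T0 \<union> form_of_clause ` KP) (totalize P)"
      using agree_is_model[OF agree_P M over] .
    moreover have "\<forall>(f, n)\<in>Sig. finite (fun_dom P f n)"
    proof (clarify, rule finite_subset)
      fix f n assume f: "(f, n) \<in> Sig"
      \<comment> \<open>Every tuple in the domain consists of the argument values of a term in the
        finite set \<open>est E K1 G\<close>; the value \<open>[]\<close> for variables is a
        dummy.\<close>
      show "fun_dom P f n \<subseteq> (\<lambda>t. case t of Var x \<Rightarrow> [] | Fn f ts \<Rightarrow> map ev ts) ` ?T"
      proof
        fix as assume "as \<in> fun_dom P f n"
        then have as: "(f, length as) \<in> Sig" "pfn P f as \<noteq> None"
          using f by (auto simp: fun_dom_def tuples_def)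
        then obtain ts where ts: "Fn f ts \<in> SubX" "map ev ts = as" using P_ext_ex by blast
        then have "Fn f ts \<in> ?T" using X_ext[of f ts] as(1) E by auto
        then show "as \<in> (\<lambda>t. case t of Var x \<Rightarrow> [] | Fn f ts \<Rightarrow> map ev ts) ` ?T"
          using ts(2) by force
      qed
      show "finite ((\<lambda>t. case t of Var x \<Rightarrow> [] | Fn f ts \<Rightarrow> map ev ts) ` ?T)" using fin by simp
    qed
    ultimately show thesis using comp weak that unfolding comp_f_def by meson
  qed
  define u0 where "u0 = (SOME u. u \<in> univ M)"
  have u0: "u0 \<in> univ M"
    using struct unfolding u0_def is_struct_def by (simp add: some_in_eq)
  \<comment> \<open>The completion says nothing about \<open>C\<close>, so its constants are
    restored from \<open>M'\<close>. A constant that does not occur in \<open>X\<close> may have a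
    value outside the universe there; it gets the default \<open>u0\<close>, which makes the
    structure closed under all of \<open>C\<close>.\<close>
  define B' where "B' = B\<lparr>fn := (\<lambda>f as. if (f, length as) \<in> C \<times> {0}
    then (if fn M' f [] \<in> univ M then fn M' f [] else u0) else fn B f as)\<rparr>"
  have B'_simps: "univ B' = univ M" "pr B' = pr B" using B(2) by (simp_all add: B'_def P_simps)
  have B'_fn: "fn B' f as = fn B f as" if "(f, length as) \<in> Sig0 \<union> SigP \<union> Sig" for f as
    using that disjoint(3) by (auto simp: B'_def)
  have B_P: "fn B f as = b"
    if "(f, length as) \<in> Sig0 \<union> SigP \<union> Sig" "set as \<subseteq> univ M" "pfn P f as = Some b" for f as b
    using weak_embedding_id[OF B(3)] that by (simp add: P_simps)
  have B_pr: "pr B p as = pr M p as" if "(p, length as) \<in> Pr" "set as \<subseteq> univ M" for p as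
    using weak_embedding_id[OF B(3)] that by (simp add: P_simps)
  have struct_B: "is_struct (Sig0 \<union> SigP \<union> Sig) B" using B(1) by (simp add: is_model_def)
  have agree_B: "agree (Sig0 \<union> SigP \<union> Sig) Pr B B'"
    using B'_fn B(2) by (auto simp: agree_def tuples_def B'_simps P_simps)
  have agree_M: "agree (Sig0 \<union> SigP) Pr M B'"
    using B'_fn B_P P_base B_pr by (auto simp: agree_def tuples_def B'_simps)
  have over_K1: "\<forall>\<phi>\<in>T0 \<union> form_of_clause ` KP \<union> form_of_clause ` K1. over_form (Sig0 \<union> SigP \<union> Sig) Pr \<phi>"
    using over K1 over_form_mono[of "Sig0 \<union> SigP" Pr _ "Sig0 \<union> SigP \<union> Sig"]
    by (auto intro: over_form_form_of_clause)
  have model: "is_model (Sig0 \<union> SigP \<union> Sig) (T0 \<union> form_of_clause ` KP \<union> form_of_clause ` K1) B'"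
    using agree_is_model[OF agree_B B(1) over_K1] .
  have B'_ev: "fn B' f (map ev ts) = ev (Fn f ts)" if t: "Fn f ts \<in> SubX" for f ts
  proof (cases "(f, length ts) \<in> C \<times> {0}")
    case True
    then have "ts = []" by auto
    then have "ev (Fn f ts) = fn M' f []" by (simp add: ev_def)
    then show ?thesis using ev_univ[OF t] True \<open>ts = []\<close> by (simp add: B'_def)
  next
    case False
    then have f: "(f, length ts) \<in> Sig0 \<union> SigP \<union> Sig" using SubX_syms[OF t] by auto
    \<comment> \<open>The completion extends \<open>P\<close>, so every value prescribed by a ground
      subterm survives in \<open>B\<close>.\<close>
    have "pfn P f (map ev ts) = Some (ev (Fn f ts))"
      using P_ext[OF t] P_base[of f "map ev ts"] ev_base[OF t] f by auto
    then show ?thesis using B_P[of f "map ev ts"] B'_fn[of f "map ev ts"] f ev_args[OF t] by simp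
  qed
  have G_B': "holds B' (form_of_clause D)" if D: "D \<in> G" for D
    unfolding holds_def
  proof (intro allI impI)
    fix v :: "nat \<Rightarrow> 'a"
    have D_X: "D \<in> X" using D by (simp add: X_eq)
    have eval_D: "eval B' v t = eval M' w (pur t) \<and> eval B' v t \<in> univ B'" if t: "t \<in> terms_clause D" for t
    proof -
      have sub: "t \<in> SubX" using D_X t by (rule SubX_terms_clause)
      then have ground: "vars t = {}" by (rule SubX_ground)
      \<comment> \<open>A ground term is its own instance under \<open>Var\<close>, and the
        condition on \<open>v\<close> holds vacuously.\<close>
      have "eval B' v t = ev (subst Var t)"
        using eval_of_ground_values[of B' ev Var t v] B'_ev sub ground subst_ground[OF ground] by simp
      then show ?thesis using ev_univ[OF sub] subst_ground[OF ground] by (simp add: ev_def B'_simps)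
    qed
    have "sat B' v (form_of_clause D) \<longleftrightarrow> sat M' w (form_of_clause (map_clause pur D))"
      using X[OF D_X] B_pr
      by (intro sat_map_clause[where Pr = Pr, OF eval_D]) (auto simp: B'_simps M' over_clause_def)
    moreover have "map_clause pur D \<in> X'" using D_X by (simp add: purified_def)
    ultimately show "sat B' v (form_of_clause D)" using M'_X by simp
  qed
  have "is_struct (Sig0 \<union> SigP \<union> Sig \<union> C \<times> {0}) B'"
    unfolding is_struct_def
  proof (intro conjI ballI, goal_cases)
    case 1
    then show ?case using u0 B'_simps by auto
  next
    case (2 fn')
    obtain f n where fn': "fn' = (f, n)" by (cases fn')
    have "fn B' f as \<in> univ B'" if as: "as \<in> tuples (univ B') n" for as
    proof (cases "(f, n) \<in> C \<times> {0}")
      case True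
      then show ?thesis using u0 as by (auto simp: B'_def B(2) P_simps tuples_def)
    next
      case False
      then show ?thesis using 2 fn' as model by (fastforce simp: is_model_def is_struct_def)
    qed
    then show ?case by (simp add: fn')
  qed
  then have "is_model (Sig0 \<union> SigP \<union> Sig \<union> C \<times> {0})
      (T0 \<union> form_of_clause ` KP \<union> form_of_clause ` K1 \<union> form_of_clause ` G) B'"
    using model G_B' by (auto simp: is_model_def)
  then show thesis using that agree_M by blast
qed

end

section \<open>Symbol elimination in chains of extensions\<close>

theorem theorem5:
  fixes Sig0 SigP Sig E :: "'f sig" and Pr :: "'p sig" and C :: "'f set"
    and T0 :: "('f, 'p) fml set" and KP K1 G :: "('f, 'p) clause set"
    and \<Phi> \<Gamma> :: "('f, 'p) fml"
  assumes T0: "is_theory Sig0 Pr T0" "allows_qe TYPE('a) Sig0 Pr T0"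
    and sigs: "SigP \<inter> Sig0 = {}" "Sig \<inter> (Sig0 \<union> SigP) = {}"
    and C: "countable C" "C \<times> {0} \<inter> (Sig0 \<union> SigP \<union> Sig) = {}"
    and KP: "\<forall>D\<in>KP. over_clause (Sig0 \<union> SigP) Pr D"
    and K1: "\<forall>D\<in>K1. over_clause (Sig0 \<union> SigP \<union> Sig) Pr D"
    and comp: "comp_f TYPE('a) Sig0 SigP Pr T0 KP"
      "comp_f TYPE('a) (Sig0 \<union> SigP) Sig Pr (T0 \<union> form_of_clause ` KP) K1"
    and below: "vars_below SigP KP" "vars_below Sig K1"
    and E: "E = SigP \<union> Sig \<or> E = Sig"
    and flat_linear: "flat SigP KP" "linear SigP KP" "flat E K1" "linear E K1"
    and G: "finite G" "\<forall>D\<in>G. ground_clause D \<and> over_clause (Sig0 \<union> SigP \<union> Sig \<union> C \<times> {0}) Pr D"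
    and alg: "symbol_elimination TYPE('a) Sig0 Pr SigP Sig C T0 E K1 G (est E K1 G) \<Phi>"
    and \<Gamma>: "universal \<Gamma>" "over_form (Sig0 \<union> SigP) Pr \<Gamma>"
    and unsat: "entails TYPE('a) (Sig0 \<union> SigP \<union> Sig \<union> C \<times> {0})
      (T0 \<union> form_of_clause ` KP \<union> {\<Gamma>} \<union> form_of_clause ` K1 \<union> form_of_clause ` G) {FBot}"
  shows "entails TYPE('a) (Sig0 \<union> SigP)
    (T0 \<union> (form_of_clause ` KP \<union> {\<Gamma>})) (form_of_clause ` KP \<union> {\<Phi>})"
proof -
  define X where "X = instances (Sig0 \<union> (SigP \<union> Sig) \<union> C \<times> {0}) E (est E K1 G) K1 \<union> G"
  let ?S1 = "SigP \<union> Sig"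
  let ?SC = "C \<times> {0} \<union> ?S1"
  let ?N = "named_terms ?S1 X"
  from alg obtain d Ds xs \<xi> \<Gamma>1 \<theta> ys \<eta> where
    fin: "finite (est E K1 G)"
    and inj_d: "inj_on d ?N" and fresh_d: "\<forall>t\<in>?N. d t \<in> C \<and> (\<forall>D\<in>X. (d t, 0) \<notin> syms_clause D)"
    and Ds: "set Ds = purified ?S1 d X" and xs: "set xs = consts_rest ?SC SigP ?S1 d X"
    and \<Gamma>1: "quantifier_free \<Gamma>1"
      "equiv_mod TYPE('a) (Sig0 \<union> (consts_p ?SC SigP ?S1 d X \<union> consts_f ?SC SigP ?S1 d X) \<times> {0}) T0
        (foldr FEx (map \<xi> xs) (consts_to_vars (consts_rest ?SC SigP ?S1 d X) \<xi> (conj_form Ds))) \<Gamma>1"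
    and dom_\<theta>: "dom \<theta> = {d (Fn f ts) | f ts. Fn f ts \<in> ?N \<and> (f, length ts) \<in> SigP}"
    and \<theta>: "\<forall>f ts. Fn f ts \<in> ?N \<and> (f, length ts) \<in> SigP \<longrightarrow>
      \<theta> (d (Fn f ts)) = Some (Fn f (map (\<lambda>s. replace_consts \<theta> (purify ?S1 d s)) ts))"
    and \<Phi>: "\<Phi> = foldr FAll (map \<eta> ys)
      (FNeg (consts_to_vars (consts_p ?SC SigP ?S1 d X - consts_f ?SC SigP ?S1 d X) \<eta>
        (map_form id (replace_consts \<theta>) \<Gamma>1)))"
    unfolding symbol_elimination_def Let_def X_def[symmetric] by blast
  \<comment> \<open>Both admissible choices of the extension symbols contain \<open>Sig\<close>,
    which lets the argument treat them uniformly.\<close>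
  have E': "Sig \<subseteq> E" using E by blast
  interpret ground_purification Sig0 SigP Sig Pr C d X
  proof
    show "SigP \<inter> Sig0 = {}" "Sig \<inter> (Sig0 \<union> SigP) = {}" "C \<times> {0} \<inter> (Sig0 \<union> SigP \<union> Sig) = {}"
      by (fact sigs C(2))+
    show "inj_on d ?N" by (rule inj_d)
    show "d t \<in> C \<and> (D \<in> X \<longrightarrow> (d t, 0) \<notin> syms_clause D)" if "t \<in> ?N" for t D
      using fresh_d that by blast
    show "ground_clause D \<and> over_clause (Sig0 \<union> SigP \<union> Sig \<union> C \<times> {0}) Pr D" if "D \<in> X" for D
      using that unfolding X_def
    proof
      assume "D \<in> instances (Sig0 \<union> (SigP \<union> Sig) \<union> C \<times> {0}) E (est E K1 G) K1"
      then obtain D' \<sigma> where D': "D = map_clause (subst \<sigma>) D'" "D' \<in> K1"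
        and \<sigma>: "\<forall>x\<in>vars_clause D'. vars (\<sigma> x) = {} \<and> syms (\<sigma> x) \<subseteq> Sig0 \<union> (SigP \<union> Sig) \<union> C \<times> {0}"
        unfolding instances_def by blast
      have over: "over_clause (Sig0 \<union> SigP \<union> Sig) Pr D'" using K1 D'(2) by blast
      have "vars (subst \<sigma> t) = {}" "syms (subst \<sigma> t) \<subseteq> Sig0 \<union> SigP \<union> Sig \<union> C \<times> {0}"
        if "t \<in> terms_clause D'" for t
      proof -
        have x: "vars t \<subseteq> vars_clause D'" using that unfolding vars_clause_def by blast
        then show "vars (subst \<sigma> t) = {}" unfolding vars_subst using \<sigma> by (simp add: subset_iff)
        have "syms t \<subseteq> Sig0 \<union> SigP \<union> Sig"
          using over that unfolding over_clause_def syms_clause_def by blast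
        moreover have "syms (\<sigma> y) \<subseteq> Sig0 \<union> SigP \<union> Sig \<union> C \<times> {0}" if "y \<in> vars t" for y
          using \<sigma>[rule_format, OF subsetD[OF x that]] by (simp add: Un_assoc)
        ultimately show "syms (subst \<sigma> t) \<subseteq> Sig0 \<union> SigP \<union> Sig \<union> C \<times> {0}"
          unfolding syms_subst by blast
      qed
      moreover have "\<forall>l\<in>set D'. psyms_lit l \<subseteq> Pr" using over by (simp add: over_clause_def)
      ultimately show ?thesis
        by (simp add: D'(1) ground_clause_terms terms_clause_map over_clause_map)
    qed (use G(2) in blast)
  qed
  have "is_model (Sig0 \<union> SigP) (T0 \<union> (form_of_clause ` KP \<union> {\<Phi>})) M"
    if M: "is_model (Sig0 \<union> SigP) (T0 \<union> (form_of_clause ` KP \<union> {\<Gamma>})) M" for M :: "('f, 'p, 'a) struct"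
  proof -
    have "\<not> sat M v (consts_to_vars (cp - cf) \<eta> (map_form id (replace_consts \<theta>) \<Gamma>1))"
      if v: "range v \<subseteq> univ M" for v
    proof
      assume sat: "sat M v (consts_to_vars (cp - cf) \<eta> (map_form id (replace_consts \<theta>) \<Gamma>1))"
      have M_T0: "is_model (Sig0 \<union> SigP) T0 M" and
        M_KP: "is_model (Sig0 \<union> SigP) (T0 \<union> form_of_clause ` KP) M"
        using M by (auto simp: is_model_def)
      obtain M' w where M': "univ M' = univ M" "pr M' = pr M" "range w \<subseteq> univ M"
        "\<And>f as. (f, length as) \<in> Sig0 \<union> SigP \<Longrightarrow> fn M' f as = fn M f as"
        "\<And>c. c \<in> consts_X' \<Longrightarrow> fn M' c [] \<in> univ M"
        "\<And>D. D \<in> X' \<Longrightarrow> sat M' w (form_of_clause D)"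
        "\<And>f ts. Fn f ts \<in> N \<Longrightarrow> (f, length ts) \<in> SigP \<Longrightarrow>
          fn M' (d (Fn f ts)) [] = fn M f (map (\<lambda>s. eval M' w (pur s)) ts)"
        using expansion[OF T0(1) M_T0 v Ds xs \<Gamma>1 dom_\<theta> \<theta>[rule_format, OF conjI] sat] by metis
      have over: "\<forall>\<phi>\<in>T0 \<union> form_of_clause ` KP. over_form (Sig0 \<union> SigP) Pr \<phi>"
        using T0(1) KP over_form_mono[of Sig0 Pr _ "Sig0 \<union> SigP"]
        by (auto simp: is_theory_def intro: over_form_form_of_clause)
      obtain B where B: "agree (Sig0 \<union> SigP) Pr M B"
        "is_model (Sig0 \<union> SigP \<union> Sig \<union> C \<times> {0})
          (T0 \<union> form_of_clause ` KP \<union> form_of_clause ` K1 \<union> form_of_clause ` G) B"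
        using completion[OF M_KP over K1 comp(2) below(2) E' flat_linear(3,4) X_def fin M'] by metis
      \<comment> \<open>\<open>\<Gamma>\<close> contains only base and parameter symbols, on which
        \<open>M\<close> and \<open>B\<close> agree.\<close>
      have "holds B \<Gamma>"
        using agree_holds[OF B(1) _ \<Gamma>(2)] M by (auto simp: is_model_def)
      then have "is_model (Sig0 \<union> SigP \<union> Sig \<union> C \<times> {0})
          (T0 \<union> form_of_clause ` KP \<union> {\<Gamma>} \<union> form_of_clause ` K1 \<union> form_of_clause ` G) B"
        using B(2) by (auto simp: is_model_def)
      then have "holds B FBot" using unsat by (auto simp: entails_def is_model_def)
      moreover have "range v \<subseteq> univ B" using v B(1) by (simp add: agree_def)
      ultimately show False by (auto simp: holds_def)
    qed
    then have "holds M \<Phi>" unfolding \<Phi> by (intro holds_foldr_FAll) (simp add: holds_def)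
    then show ?thesis using M by (auto simp: is_model_def)
  qed
  moreover have "is_model S \<Psi> M" if "is_model S (\<Phi>' \<union> \<Psi>) M" for S \<Phi>' \<Psi> and M :: "('f, 'p, 'a) struct"
    using that by (simp add: is_model_def)
  ultimately show ?thesis unfolding entails_def by metis
qed

end
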